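(* The category of d-Boolean spaces (with continuous maps) is a simultaneously reflective and coreflective full subcategory of the category of d-spectral spaces and d-spectral maps; that is, d-Boolean spaces and continuous maps form a full subcategory of the category of d-spectral spaces and d-spectral maps, and the inclusion functor has both a left adjoint and a right adjoint.
   Context: A bitopological space is a triple $(X,\tau_+,\tau_-)$ with $X$ a set and $\tau_+,\tau_-$ topologies on $X$. A continuous map $f\colon(X,\tau_+,\tau_-)\to(X',\tau'_+,\tau'_-)$ is a function continuous both as $(X,\tau_+)\to(X',\tau_+')$ and as $(X,\tau_-)\to(X',\tau'_-)$. A bitopological space is compact (resp. $T_0$) if $(X,\tau_+\vee\tau_-)$ is compact (resp. $T_0$), where $\vee$ denotes the join of topologies. It is zero-dimensional if $\tau_+$ has a basis of $\tau_-$-closed sets and $\tau_-$ has a basis of $\tau_+$-closed sets. A d-Boolean space is a compact, $T_0$, zero-dimensional bitopological space. An element $x$ of a poset is finite if for each directed subset $D$ having a join with $x\sqsubseteq\bigsqcup D$, one has $x\sqsubseteq d$ for some $d\in D$. A frame is coherent if every element is a join of finite elements, $1$ is finite, and the meet of two finite elements is finite. $(X,\tau_+,\tau_-)$ is d-sober if for every pair $(K_+,K_-)$, where $K_+$ is a (nonempty) irreducible closed set of $(X,\tau_+)$ and $K_-$ a (nonempty) irreducible closed set of $(X,\tau_-)$, such that for all $U\in\tau_+$, $V\in\tau_-$: (i) $U\cap V=\varnothing$ implies $K_+\cap U=\varnothing$ or $K_-\cap V=\varnothing$; (ii) $U\cup V=X$ implies $K_+\cap U\ne\varnothing$ or $K_-\cap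 V\neq\varnothing$; there is a unique $x\in X$ such that $K_+$ is the $\tau_+$-closure of $\{x\}$ and $K_-$ is the $\tau_-$-closure of $\{x\}$. $(X,\tau_+,\tau_-)$ is d-spectral if it is compact, d-sober, and both $\tau_+$ and $\tau_-$ are coherent frames. A continuous map $f$ between bitopological spaces is d-spectral if both $f\colon(X,\tau_+)\to(X',\tau_+')$ and $f\colon(X,\tau_-)\to(X',\tau'_-)$ are spectral maps, i.e. continuous maps for which the preimage of every compact open set is compact open. *)

theory Defs
  imports "HOL-Analysis.Analysis"
begin

section \<open>Coherent frames\<close>

text \<open>
  A poset is a carrier \<open>P\<close> in a type of class \<open>order\<close>, with the induced order.  For the frame of
  open sets of a topology the ambient order is set inclusion.  Joins and meets are taken inside
  \<open>P\<close>, not in the ambient type.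
\<close>

definition is_join :: "'p::order set \<Rightarrow> 'p set \<Rightarrow> 'p \<Rightarrow> bool" where
  "is_join P S j \<longleftrightarrow> j \<in> P \<and> (\<forall>s\<in>S. s \<le> j) \<and> (\<forall>u\<in>P. (\<forall>s\<in>S. s \<le> u) \<longrightarrow> j \<le> u)"

definition is_meet :: "'p::order set \<Rightarrow> 'p set \<Rightarrow> 'p \<Rightarrow> bool" where
  "is_meet P S m \<longleftrightarrow> m \<in> P \<and> (\<forall>s\<in>S. m \<le> s) \<and> (\<forall>l\<in>P. (\<forall>s\<in>S. l \<le> s) \<longrightarrow> l \<le> m)"

definition directed_set :: "'p::order set \<Rightarrow> bool" where
  "directed_set D \<longleftrightarrow> D \<noteq> {} \<and> (\<forall>a\<in>D. \<forall>b\<in>D. \<exists>c\<in>D. a \<le> c \<and> b \<le> c)"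

definition finite_element :: "'p::order set \<Rightarrow> 'p \<Rightarrow> bool" where
  "finite_element P x \<longleftrightarrow> x \<in> P \<and>
     (\<forall>D j. D \<subseteq> P \<and> directed_set D \<and> is_join P D j \<and> x \<le> j \<longrightarrow> (\<exists>d\<in>D. x \<le> d))"

definition is_frame :: "'p::order set \<Rightarrow> bool" where
  "is_frame P \<longleftrightarrow>
     (\<forall>S\<subseteq>P. \<exists>j. is_join P S j) \<and>
     (\<forall>a\<in>P. \<forall>S\<subseteq>P. \<forall>j m. is_join P S j \<and> is_meet P {a, j} m \<longrightarrow>
        is_join P {b. \<exists>s\<in>S. is_meet P {a, s} b} m)"

definition coherent_frame :: "'p::order set \<Rightarrow> bool" where
  "coherent_frame P \<longleftrightarrow> is_frame P \<and>
     (\<forall>x\<in>P. \<exists>S. (\<forall>s\<in>S. finite_element P s) \<and> is_join P S x) \<and>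
     (\<exists>t\<in>P. (\<forall>x\<in>P. x \<le> t) \<and> finite_element P t) \<and>
     (\<forall>x y m. finite_element P x \<and> finite_element P y \<and> is_meet P {x, y} m \<longrightarrow>
        finite_element P m)"


section \<open>Bitopological spaces\<close>

text \<open>
  An element of this type is a bitopological space when its two topologies have the same
  underlying set, which is required by \<open>bitop_space\<close> below.
\<close>

datatype 'a bitop = Bitop (pos: "'a topology") (neg: "'a topology")

definition bitop_space :: "'a bitop \<Rightarrow> bool" where
  "bitop_space X \<longleftrightarrow> topspace (pos X) = topspace (neg X)"

abbreviation points :: "'a bitop \<Rightarrow> 'a set" where
  "points X \<equiv> topspace (pos X)"

definition join_topology :: "'a bitop \<Rightarrow> 'a topology" where
  "join_topology X = topology_generated_by ({U. openin (pos X) U} \<union> {V. openin (neg X) V})"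

definition bicontinuous :: "'a bitop \<Rightarrow> 'b bitop \<Rightarrow> ('a \<Rightarrow> 'b) \<Rightarrow> bool" where
  "bicontinuous X Y f \<longleftrightarrow> continuous_map (pos X) (pos Y) f \<and> continuous_map (neg X) (neg Y) f"

definition has_basis_of_closed :: "'a topology \<Rightarrow> 'a topology \<Rightarrow> bool" where
  "has_basis_of_closed S T \<longleftrightarrow>
     (\<exists>\<B>. (\<forall>B\<in>\<B>. closedin T B) \<and> openin S = arbitrary union_of (\<lambda>B. B \<in> \<B>))"

definition zero_dimensional :: "'a bitop \<Rightarrow> bool" where
  "zero_dimensional X \<longleftrightarrow> has_basis_of_closed (pos X) (neg X) \<and> has_basis_of_closed (neg X) (pos X)"

definition d_boolean :: "'a bitop \<Rightarrow> bool" where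
  "d_boolean X \<longleftrightarrow> bitop_space X \<and> compact_space (join_topology X) \<and>
     t0_space (join_topology X) \<and> zero_dimensional X"

definition irreducible_closedin :: "'a topology \<Rightarrow> 'a set \<Rightarrow> bool" where
  "irreducible_closedin T K \<longleftrightarrow> closedin T K \<and> K \<noteq> {} \<and>
     (\<forall>A B. closedin T A \<and> closedin T B \<and> K = A \<union> B \<longrightarrow> K = A \<or> K = B)"

definition d_sober :: "'a bitop \<Rightarrow> bool" where
  "d_sober X \<longleftrightarrow>
     (\<forall>K L. irreducible_closedin (pos X) K \<and> irreducible_closedin (neg X) L \<and>
        (\<forall>U V. openin (pos X) U \<and> openin (neg X) V \<longrightarrow>
           (U \<inter> V = {} \<longrightarrow> K \<inter> U = {} \<or> L \<inter> V = {}) \<and>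
           (U \<union> V = points X \<longrightarrow> K \<inter> U \<noteq> {} \<or> L \<inter> V \<noteq> {})) \<longrightarrow>
        (\<exists>!x. x \<in> points X \<and> K = pos X closure_of {x} \<and> L = neg X closure_of {x}))"

definition d_spectral :: "'a bitop \<Rightarrow> bool" where
  "d_spectral X \<longleftrightarrow> bitop_space X \<and> compact_space (join_topology X) \<and> d_sober X \<and>
     coherent_frame {U. openin (pos X) U} \<and> coherent_frame {V. openin (neg X) V}"

definition spectral_map :: "'a topology \<Rightarrow> 'b topology \<Rightarrow> ('a \<Rightarrow> 'b) \<Rightarrow> bool" where
  "spectral_map S T f \<longleftrightarrow> continuous_map S T f \<and>
     (\<forall>U. openin T U \<and> compactin T U \<longrightarrow>
        openin S {x \<in> topspace S. f x \<in> U} \<and> compactin S {x \<in> topspace S. f x \<in> U})"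

definition d_spectral_map :: "'a bitop \<Rightarrow> 'b bitop \<Rightarrow> ('a \<Rightarrow> 'b) \<Rightarrow> bool" where
  "d_spectral_map X Y f \<longleftrightarrow> spectral_map (pos X) (pos Y) f \<and> spectral_map (neg X) (neg Y) f"


section \<open>Categories, functors, adjunctions\<close>

text \<open>
  Hom-sets are indexed by domain and codomain and need not be disjoint, so composition and the
  action of a functor on morphisms take the objects as explicit arguments:
  \<open>comp C X Y Z g f\<close> is the composite of \<open>f\<close> from \<open>X\<close> to \<open>Y\<close> and \<open>g\<close> from \<open>Y\<close> to \<open>Z\<close>.
\<close>

record ('o, 'm) cat =
  obj :: "'o set"
  hom :: "'o \<Rightarrow> 'o \<Rightarrow> 'm set"
  ident :: "'o \<Rightarrow> 'm"
  comp :: "'o \<Rightarrow> 'o \<Rightarrow> 'o \<Rightarrow> 'm \<Rightarrow> 'm \<Rightarrow> 'm"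

definition category :: "('o, 'm) cat \<Rightarrow> bool" where
  "category C \<longleftrightarrow>
     (\<forall>X\<in>obj C. ident C X \<in> hom C X X) \<and>
     (\<forall>X\<in>obj C. \<forall>Y\<in>obj C. \<forall>Z\<in>obj C. \<forall>f\<in>hom C X Y. \<forall>g\<in>hom C Y Z.
        comp C X Y Z g f \<in> hom C X Z) \<and>
     (\<forall>X\<in>obj C. \<forall>Y\<in>obj C. \<forall>f\<in>hom C X Y.
        comp C X X Y f (ident C X) = f \<and> comp C X Y Y (ident C Y) f = f) \<and>
     (\<forall>W\<in>obj C. \<forall>X\<in>obj C. \<forall>Y\<in>obj C. \<forall>Z\<in>obj C.
        \<forall>f\<in>hom C W X. \<forall>g\<in>hom C X Y. \<forall>h\<in>hom C Y Z.
        comp C W X Z (comp C X Y Z h g) f = comp C W Y Z h (comp C W X Y g f))"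

definition full_subcategory :: "('o, 'm) cat \<Rightarrow> ('o, 'm) cat \<Rightarrow> bool" where
  "full_subcategory B C \<longleftrightarrow> category B \<and> category C \<and> obj B \<subseteq> obj C \<and>
     (\<forall>X\<in>obj B. \<forall>Y\<in>obj B. hom B X Y = hom C X Y) \<and>
     (\<forall>X\<in>obj B. ident B X = ident C X) \<and>
     (\<forall>X\<in>obj B. \<forall>Y\<in>obj B. \<forall>Z\<in>obj B. \<forall>f\<in>hom B X Y. \<forall>g\<in>hom B Y Z.
        comp B X Y Z g f = comp C X Y Z g f)"

record ('o, 'm, 'p, 'n) ftor =
  omap :: "'o \<Rightarrow> 'p"
  amap :: "'o \<Rightarrow> 'o \<Rightarrow> 'm \<Rightarrow> 'n"

definition is_functor :: "('o, 'm) cat \<Rightarrow> ('p, 'n) cat \<Rightarrow> ('o, 'm, 'p, 'n) ftor \<Rightarrow> bool" where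
  "is_functor C D F \<longleftrightarrow>
     (\<forall>X\<in>obj C. omap F X \<in> obj D) \<and>
     (\<forall>X\<in>obj C. \<forall>Y\<in>obj C. \<forall>f\<in>hom C X Y. amap F X Y f \<in> hom D (omap F X) (omap F Y)) \<and>
     (\<forall>X\<in>obj C. amap F X X (ident C X) = ident D (omap F X)) \<and>
     (\<forall>X\<in>obj C. \<forall>Y\<in>obj C. \<forall>Z\<in>obj C. \<forall>f\<in>hom C X Y. \<forall>g\<in>hom C Y Z.
        amap F X Z (comp C X Y Z g f) =
        comp D (omap F X) (omap F Y) (omap F Z) (amap F Y Z g) (amap F X Y f))"

definition inclusion :: "('o, 'm, 'o, 'm) ftor" where
  "inclusion = \<lparr>omap = (\<lambda>X. X), amap = (\<lambda>X Y f. f)\<rparr>"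

text \<open>
  \<open>left_adjoint C D F G\<close>: the functor \<open>F\<close> from \<open>C\<close> to \<open>D\<close> is left adjoint to the functor \<open>G\<close> from
  \<open>D\<close> to \<open>C\<close>, via bijections \<open>\<phi> X Y\<close> from \<open>hom D (F X) Y\<close> to \<open>hom C X (G Y)\<close> that are natural in
  both arguments: \<open>\<phi> (k \<circ> f \<circ> F h) = G k \<circ> \<phi> f \<circ> h\<close>.
\<close>

definition left_adjoint ::
  "('o, 'm) cat \<Rightarrow> ('p, 'n) cat \<Rightarrow> ('o, 'm, 'p, 'n) ftor \<Rightarrow> ('p, 'n, 'o, 'm) ftor \<Rightarrow> bool" where
  "left_adjoint C D F G \<longleftrightarrow> is_functor C D F \<and> is_functor D C G \<and>
     (\<exists>\<phi>.
        (\<forall>X\<in>obj C. \<forall>Y\<in>obj D. bij_betw (\<phi> X Y) (hom D (omap F X) Y) (hom C X (omap G Y))) \<and>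
        (\<forall>X\<in>obj C. \<forall>X'\<in>obj C. \<forall>Y\<in>obj D. \<forall>Y'\<in>obj D.
           \<forall>h\<in>hom C X' X. \<forall>f\<in>hom D (omap F X) Y. \<forall>k\<in>hom D Y Y'.
           \<phi> X' Y' (comp D (omap F X') Y Y' k
                      (comp D (omap F X') (omap F X) Y f (amap F X' X h))) =
           comp C X' (omap G Y) (omap G Y') (amap G Y Y' k)
             (comp C X' X (omap G Y) (\<phi> X Y f) h)))"

definition reflective_subcategory :: "('o, 'm) cat \<Rightarrow> ('o, 'm) cat \<Rightarrow> bool" where
  "reflective_subcategory B C \<longleftrightarrow>
     full_subcategory B C \<and> (\<exists>F. left_adjoint C B F inclusion)"

definition coreflective_subcategory :: "('o, 'm) cat \<Rightarrow> ('o, 'm) cat \<Rightarrow> bool" where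
  "coreflective_subcategory B C \<longleftrightarrow>
     full_subcategory B C \<and> (\<exists>G. left_adjoint B C inclusion G)"


section \<open>The two categories of spaces\<close>

text \<open>
  The parameter \<open>\<U>\<close> is the universe of admissible underlying sets.  For \<open>\<U> = UNIV\<close> the objects are
  all spaces with points in \<open>'a\<close>; a size restriction (small sets) is obtained by taking for \<open>\<U>\<close> the
  sets of cardinality below some bound.

  A morphism is a function on the underlying set of its domain; to make equality of morphisms
  the equality of such functions, it is represented by its extension with value \<open>undefined\<close>
  outside that set.
\<close>

definition bitop_cat ::
  "'a bitop set \<Rightarrow> ('a bitop \<Rightarrow> 'a bitop \<Rightarrow> ('a \<Rightarrow> 'a) \<Rightarrow> bool) \<Rightarrow> ('a bitop, 'a \<Rightarrow> 'a) cat" where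
  "bitop_cat Ob M =
     \<lparr>obj = Ob,
      hom = (\<lambda>X Y. {f \<in> extensional (points X). M X Y f}),
      ident = (\<lambda>X. restrict (\<lambda>x. x) (points X)),
      comp = (\<lambda>X Y Z g f. compose (points X) g f)\<rparr>"

definition dBool :: "'a set set \<Rightarrow> ('a bitop, 'a \<Rightarrow> 'a) cat" where
  "dBool \<U> = bitop_cat {X. d_boolean X \<and> points X \<in> \<U>} bicontinuous"

definition dSpec :: "'a set set \<Rightarrow> ('a bitop, 'a \<Rightarrow> 'a) cat" where
  "dSpec \<U> = bitop_cat {X. d_spectral X \<and> points X \<in> \<U>} d_spectral_map"

end

theory Submission
  imports Defs
begin

text \<open>
  Both adjoints rest on the biclopen sets: open in the first topology and closed in the second.
  In a compact bitopological space they are compact in the first topology, and in a d-Boolean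
  space they are all the compact open sets; hence a map from a d-spectral to a d-Boolean space is
  d-spectral as soon as it is bicontinuous.

  The coreflection keeps the points of a d-spectral space and refines each topology by the
  complements of the compact open sets of the other one.  This patch is compact since its
  ultrafilters, here given by their dual prime ideals of subsets, converge: the compact open sets
  outside a prime ideal determine a pair of irreducible closed sets, to which d-sobriety applies.

  The reflection coarsens the topologies to those generated by the biclopen sets and by
  their complements, respectively, and passes to the \<open>T\<^sub>0\<close> quotient.  The quotient is realised on a set of
  representatives, so that its points form a subset of the original ones.
\<close>

section \<open>Frames of open sets\<close>

text \<open>The two topologies play symmetric roles, so most facts are proved for the first one and
  carried over by exchanging them. The exchange replaces biclopen sets by their complements, and
  preimages commute with complements; hence one condition on biclopen sets controls a map for both
  topologies at once. For the same reason both adjoints come from one construction: a family of sets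
  is made biclopen by generating the first topology from it and the second from the complements.

  The coreflection leaves the underlying functions of morphisms alone, so its hom-set bijection is
  the identity. The reflection coarsens the topologies, which may leave distinct points inseparable,
  so points have to be identified. All objects must have their points in one type and their point
  sets in the universe \<open>\<U>\<close>; this is why representatives stand in for equivalence
  classes and why \<open>\<U>\<close> is taken to be closed under subsets.\<close>

definition compact_opens :: "'a topology \<Rightarrow> 'a set set" where
  "compact_opens T = {U. openin T U \<and> compactin T U}"

lemma compact_opens_subset: "U \<in> compact_opens T \<Longrightarrow> U \<subseteq> topspace T"
  by (simp add: compact_opens_def openin_subset)

lemma is_join_opens:
  assumes "S \<subseteq> {U. openin T U}"
  shows "is_join {U. openin T U} S j \<longleftrightarrow> j = \<Union>S"
proof
  assume j: "is_join {U. openin T U} S j"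
  have "openin T (\<Union>S)"
    using assms by auto
  with j show "j = \<Union>S"
    unfolding is_join_def by (metis Sup_upper Union_least mem_Collect_eq subset_antisym)
next
  assume "j = \<Union>S"
  then show "is_join {U. openin T U} S j"
    using assms unfolding is_join_def by auto
qed

lemma is_meet_opens:
  assumes "openin T a" "openin T b"
  shows "is_meet {U. openin T U} {a, b} m \<longleftrightarrow> m = a \<inter> b"
proof
  assume m: "is_meet {U. openin T U} {a, b} m"
  have "openin T (a \<inter> b)"
    using assms by auto
  with m show "m = a \<inter> b"
    unfolding is_meet_def by (simp add: subset_antisym)
next
  assume "m = a \<inter> b"
  then show "is_meet {U. openin T U} {a, b} m"
    using assms unfolding is_meet_def by auto
qed

lemma is_frame_opens: "is_frame {U. openin T U}"
  unfolding is_frame_def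
proof (intro conjI allI impI ballI)
  fix S assume S: "S \<subseteq> {U. openin T U}"
  then show "\<exists>j. is_join {U. openin T U} S j"
    by (simp add: is_join_opens)
next
  fix a S j m
  assume a: "a \<in> {U. openin T U}" and S: "S \<subseteq> {U. openin T U}"
    and jm: "is_join {U. openin T U} S j \<and> is_meet {U. openin T U} {a, j} m"
  have j: "j = \<Union>S"
    using S is_join_opens jm by blast
  then have "openin T j"
    using S by auto
  then have m: "m = a \<inter> \<Union>S"
    using a j jm is_meet_opens by blast
  have "{b. \<exists>s\<in>S. is_meet {U. openin T U} {a, s} b} = {a \<inter> s |s. s \<in> S}"
  proof -
    have "is_meet {U. openin T U} {a, s} b \<longleftrightarrow> b = a \<inter> s" if "s \<in> S" for s b
      using that a S by (intro is_meet_opens) auto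
    then show ?thesis
      by blast
  qed
  moreover have "{a \<inter> s |s. s \<in> S} \<subseteq> {U. openin T U}"
    using a S by auto
  ultimately show "is_join {U. openin T U} {b. \<exists>s\<in>S. is_meet {U. openin T U} {a, s} b} m"
    using m by (auto simp: is_join_opens)
qed

lemma directed_finite_upper_bound:
  assumes "directed_set D" "finite F" "F \<subseteq> D"
  shows "\<exists>d\<in>D. \<forall>a\<in>F. a \<le> d"
  using assms(2,3)
proof (induction F)
  case empty
  then show ?case
    using assms(1) by (auto simp: directed_set_def)
next
  case (insert a F)
  then obtain d where "d \<in> D" "\<forall>a\<in>F. a \<le> d"
    by auto
  moreover obtain c where "c \<in> D" "a \<le> c" "d \<le> c"
    using assms(1) insert.prems \<open>d \<in> D\<close> unfolding directed_set_def by blast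
  ultimately show ?case
    by (intro bexI[of _ c]) (auto intro: order_trans)
qed

text \<open>The finite unions of members of an open cover form a directed family with the same
  union, so order-theoretic finiteness yields a finite subcover. Conversely, a finite subcover drawn
  from a directed family is bounded by one member of that family.\<close>

lemma finite_element_opens:
  "finite_element {U. openin T U} U \<longleftrightarrow> U \<in> compact_opens T"
proof
  assume fin: "finite_element {U. openin T U} U"
  then have U: "openin T U"
    by (simp add: finite_element_def)
  have "\<exists>\<F>. finite \<F> \<and> \<F> \<subseteq> \<U> \<and> U \<subseteq> \<Union>\<F>"
    if \<U>: "\<forall>V\<in>\<U>. openin T V" "U \<subseteq> \<Union>\<U>" for \<U>
  proof -
    define D where "D = {\<Union>\<F> |\<F>. finite \<F> \<and> \<F> \<subseteq> \<U>}"
    have D: "D \<subseteq> {U. openin T U}"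
      using \<U> by (auto simp: D_def)
    have "directed_set D"
      unfolding directed_set_def
    proof (intro conjI ballI)
      show "D \<noteq> {}"
        unfolding D_def by blast
      fix a b assume "a \<in> D" "b \<in> D"
      then obtain \<F> \<G> where "finite \<F>" "\<F> \<subseteq> \<U>" "a = \<Union>\<F>" "finite \<G>" "\<G> \<subseteq> \<U>" "b = \<Union>\<G>"
        unfolding D_def by blast
      then show "\<exists>c\<in>D. a \<le> c \<and> b \<le> c"
        unfolding D_def by (intro bexI[of _ "\<Union>(\<F> \<union> \<G>)"]) (auto intro!: exI[of _ "\<F> \<union> \<G>"])
    qed
    moreover have "is_join {U. openin T U} D (\<Union>D)"
      using D by (simp add: is_join_opens)
    moreover have "\<Union>\<U> \<subseteq> \<Union>D"
    proof
      fix x assume "x \<in> \<Union>\<U>"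
      then obtain V where "V \<in> \<U>" "x \<in> V"
        by blast
      then have "\<Union>{V} \<in> D"
        unfolding D_def by blast
      with \<open>x \<in> V\<close> show "x \<in> \<Union>D"
        by auto
    qed
    with \<U> have "U \<le> \<Union>D"
      by blast
    ultimately obtain d where "d \<in> D" "U \<subseteq> d"
      using fin D unfolding finite_element_def by blast
    then show ?thesis
      by (auto simp: D_def)
  qed
  with U show "U \<in> compact_opens T"
    by (simp add: compact_opens_def compactin_def openin_subset)
next
  assume "U \<in> compact_opens T"
  then have U: "openin T U" "compactin T U"
    by (auto simp: compact_opens_def)
  have "\<exists>d\<in>D. U \<subseteq> d"
    if D: "D \<subseteq> {U. openin T U}" "directed_set D" "is_join {U. openin T U} D j" "U \<subseteq> j" for D j
  proof -
    have "U \<subseteq> \<Union>D"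
      using D is_join_opens by blast
    then obtain \<F> where \<F>: "finite \<F>" "\<F> \<subseteq> D" "U \<subseteq> \<Union>\<F>"
      using U(2) D(1) unfolding compactin_def by (metis mem_Collect_eq subsetD)
    then obtain d where "d \<in> D" "\<forall>a\<in>\<F>. a \<subseteq> d"
      using directed_finite_upper_bound D(2) by metis
    with \<F> show ?thesis
      by blast
  qed
  with U show "finite_element {U. openin T U} U"
    by (auto simp: finite_element_def)
qed

text \<open>The frame laws hold for every topology, and each remaining clause of coherence matches
  one topological condition. All later arguments use coherence in this form.\<close>

lemma coherent_frame_opens_iff:
  "coherent_frame {U. openin T U} \<longleftrightarrow>
     compact_space T \<and>
     (\<forall>U x. openin T U \<and> x \<in> U \<longrightarrow> (\<exists>K\<in>compact_opens T. x \<in> K \<and> K \<subseteq> U)) \<and>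
     (\<forall>K\<in>compact_opens T. \<forall>L\<in>compact_opens T. K \<inter> L \<in> compact_opens T)"
    (is "?lhs \<longleftrightarrow> ?top \<and> ?base \<and> ?inter")
proof -
  have "?top \<longleftrightarrow> (\<exists>t\<in>{U. openin T U}. (\<forall>x\<in>{U. openin T U}. x \<subseteq> t) \<and> t \<in> compact_opens T)"
  proof
    assume ?top
    then show "\<exists>t\<in>{U. openin T U}. (\<forall>x\<in>{U. openin T U}. x \<subseteq> t) \<and> t \<in> compact_opens T"
      by (intro bexI[of _ "topspace T"])
        (auto simp: compact_space_def compact_opens_def openin_subset)
  next
    assume "\<exists>t\<in>{U. openin T U}. (\<forall>x\<in>{U. openin T U}. x \<subseteq> t) \<and> t \<in> compact_opens T"
    then show ?top
      by (metis compact_opens_def compact_space_def mem_Collect_eq openin_subset openin_topspace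
          subset_antisym)
  qed
  moreover have "?base \<longleftrightarrow>
    (\<forall>U\<in>{U. openin T U}. \<exists>S. (\<forall>s\<in>S. s \<in> compact_opens T) \<and> is_join {U. openin T U} S U)"
  proof
    assume base: ?base
    show "\<forall>U\<in>{U. openin T U}. \<exists>S. (\<forall>s\<in>S. s \<in> compact_opens T) \<and> is_join {U. openin T U} S U"
    proof
      fix U assume U: "U \<in> {U. openin T U}"
      define S where "S = {K \<in> compact_opens T. K \<subseteq> U}"
      have "U = \<Union>S"
        using base U unfolding S_def by blast
      moreover have "S \<subseteq> {U. openin T U}"
        by (auto simp: S_def compact_opens_def)
      ultimately have "is_join {U. openin T U} S U"
        by (simp add: is_join_opens)
      then show "\<exists>S. (\<forall>s\<in>S. s \<in> compact_opens T) \<and> is_join {U. openin T U} S U"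
        by (intro exI[of _ S]) (simp add: S_def)
    qed
  next
    assume joins:
      "\<forall>U\<in>{U. openin T U}. \<exists>S. (\<forall>s\<in>S. s \<in> compact_opens T) \<and> is_join {U. openin T U} S U"
    show ?base
    proof (intro allI impI)
      fix U x assume "openin T U \<and> x \<in> U"
      then obtain S where S: "\<forall>s\<in>S. s \<in> compact_opens T" "is_join {U. openin T U} S U" and x: "x \<in> U"
        using joins by blast
      moreover have "S \<subseteq> {U. openin T U}"
        using S by (auto simp: compact_opens_def)
      ultimately have "U = \<Union>S"
        by (simp add: is_join_opens)
      then obtain K where "K \<in> S" "x \<in> K" "K \<subseteq> U"
        using x by auto
      with S(1) show "\<exists>K\<in>compact_opens T. x \<in> K \<and> K \<subseteq> U"
        by blast
    qed
  qed
  moreover have "?inter \<longleftrightarrow> (\<forall>x y m. x \<in> compact_opens T \<and> y \<in> compact_opens T \<and>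
      is_meet {U. openin T U} {x, y} m \<longrightarrow> m \<in> compact_opens T)"
  proof (intro iffI allI ballI impI)
    fix x y m
    assume inter: ?inter
      and xy: "x \<in> compact_opens T \<and> y \<in> compact_opens T \<and> is_meet {U. openin T U} {x, y} m"
    then have "m = x \<inter> y"
      using is_meet_opens[of T x y m] by (simp add: compact_opens_def)
    with inter xy show "m \<in> compact_opens T"
      by blast
  next
    fix x y
    assume meets: "\<forall>x y m. x \<in> compact_opens T \<and> y \<in> compact_opens T \<and>
      is_meet {U. openin T U} {x, y} m \<longrightarrow> m \<in> compact_opens T"
      and xy: "x \<in> compact_opens T" "y \<in> compact_opens T"
    have "openin T x" "openin T y"
      using xy by (simp_all add: compact_opens_def)
    then have "is_meet {U. openin T U} {x, y} (x \<inter> y)"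
      by (simp only: is_meet_opens)
    with xy show "x \<inter> y \<in> compact_opens T"
      using meets[rule_format, of x y "x \<inter> y"] by (simp only: simp_thms)
  qed
  moreover have "?lhs \<longleftrightarrow>
    (\<forall>U\<in>{U. openin T U}. \<exists>S. (\<forall>s\<in>S. s \<in> compact_opens T) \<and> is_join {U. openin T U} S U) \<and>
    (\<exists>t\<in>{U. openin T U}. (\<forall>x\<in>{U. openin T U}. x \<subseteq> t) \<and> t \<in> compact_opens T) \<and>
    (\<forall>x y m. x \<in> compact_opens T \<and> y \<in> compact_opens T \<and>
      is_meet {U. openin T U} {x, y} m \<longrightarrow> m \<in> compact_opens T)"
    unfolding coherent_frame_def finite_element_opens by (simp only: is_frame_opens simp_thms)
  ultimately show ?thesis
    by argo
qed

section \<open>Bitopological spaces\<close>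

text \<open>Lets a lemma about \<open>pos\<close> be reused for \<open>neg\<close>.\<close>

definition swap :: "'a bitop \<Rightarrow> 'a bitop" where
  "swap X = Bitop (neg X) (pos X)"

lemma swap_sel [simp]: "pos (swap X) = neg X" "neg (swap X) = pos X" "swap (swap X) = X"
  by (simp_all add: swap_def)

lemma join_topology_swap [simp]: "join_topology (swap X) = join_topology X"
  by (simp add: join_topology_def Un_commute)

lemma bitop_space_swap [simp]: "bitop_space (swap X) \<longleftrightarrow> bitop_space X"
  by (auto simp: bitop_space_def)

lemma bicontinuous_swap [simp]: "bicontinuous (swap X) (swap Y) f \<longleftrightarrow> bicontinuous X Y f"
  by (auto simp: bicontinuous_def)

lemma zero_dimensional_swap [simp]: "zero_dimensional (swap X) \<longleftrightarrow> zero_dimensional X"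
  by (auto simp: zero_dimensional_def)

lemma d_boolean_swap [simp]: "d_boolean (swap X) \<longleftrightarrow> d_boolean X"
  by (simp add: d_boolean_def)

lemma d_spectral_map_swap [simp]: "d_spectral_map (swap X) (swap Y) f \<longleftrightarrow> d_spectral_map X Y f"
  by (auto simp: d_spectral_map_def)

lemma openin_join_pos: "openin (pos X) U \<Longrightarrow> openin (join_topology X) U"
  and openin_join_neg: "openin (neg X) U \<Longrightarrow> openin (join_topology X) U"
  unfolding join_topology_def by (rule topology_generated_by_Basis, simp)+

lemma topspace_join: "bitop_space X \<Longrightarrow> topspace (join_topology X) = points X"
  unfolding join_topology_def topology_generated_by_topspace Union_Un_distrib
  by (simp add: bitop_space_def flip: topspace_def)

lemma closedin_join_neg:
  assumes "bitop_space X" "closedin (neg X) U"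
  shows "closedin (join_topology X) U"
  using assms by (metis bitop_space_def closedin_def openin_join_neg topspace_join)

section \<open>Biclopen sets and d-Boolean spaces\<close>

definition biclopens :: "'a bitop \<Rightarrow> 'a set set" where
  "biclopens X = {U. openin (pos X) U \<and> closedin (neg X) U}"

lemma biclopens_swap:
  assumes "bitop_space X"
  shows "U \<in> biclopens (swap X) \<longleftrightarrow> U \<subseteq> points X \<and> points X - U \<in> biclopens X"
  using assms unfolding biclopens_def bitop_space_def
  by (auto simp: closedin_def openin_subset double_diff)

text \<open>A set closed in the second topology is closed in the compact join, hence compact there,
  and compactness passes down to the coarser first topology.\<close>

lemma biclopens_subset_compact_opens:
  assumes X: "bitop_space X" "compact_space (join_topology X)"
  shows "biclopens X \<subseteq> compact_opens (pos X)"
proof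
  fix U assume U: "U \<in> biclopens X"
  then have "compactin (join_topology X) U"
    using X by (simp add: biclopens_def closedin_compact_space closedin_join_neg)
  then have "compactin (pos X) U"
    using X openin_join_pos by (metis (no_types, lifting) compactin_contractive topspace_join)
  with U show "U \<in> compact_opens (pos X)"
    by (auto simp: compact_opens_def biclopens_def)
qed

text \<open>If some basis of \<open>S\<close> consists of \<open>T\<close>-closed sets, then all
  \<open>S\<close>-open \<open>T\<close>-closed sets together form one; this removes the existential
  over bases.\<close>

lemma has_basis_of_closed_iff:
  "has_basis_of_closed S T \<longleftrightarrow>
     (\<forall>U x. openin S U \<and> x \<in> U \<longrightarrow> (\<exists>B. openin S B \<and> closedin T B \<and> x \<in> B \<and> B \<subseteq> U))"
proof
  assume "has_basis_of_closed S T"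
  then show "\<forall>U x. openin S U \<and> x \<in> U \<longrightarrow> (\<exists>B. openin S B \<and> closedin T B \<and> x \<in> B \<and> B \<subseteq> U)"
    unfolding has_basis_of_closed_def openin_topology_base_unique by blast
next
  assume "\<forall>U x. openin S U \<and> x \<in> U \<longrightarrow> (\<exists>B. openin S B \<and> closedin T B \<and> x \<in> B \<and> B \<subseteq> U)"
  then show "has_basis_of_closed S T"
    unfolding has_basis_of_closed_def openin_topology_base_unique
    by (intro exI[of _ "{B. openin S B \<and> closedin T B}"]) blast
qed

lemma d_boolean_base:
  assumes "d_boolean X" "openin (pos X) U" "x \<in> U"
  obtains B where "B \<in> biclopens X" "x \<in> B" "B \<subseteq> U"
proof -
  have "has_basis_of_closed (pos X) (neg X)"
    using assms(1) by (simp add: d_boolean_def zero_dimensional_def)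
  with assms(2,3) that show thesis
    unfolding has_basis_of_closed_iff biclopens_def by blast
qed

lemma openin_d_boolean:
  assumes "d_boolean X"
  shows "openin (pos X) = arbitrary union_of (\<lambda>U. U \<in> biclopens X)"
  unfolding openin_topology_base_unique
proof (intro conjI allI impI)
  show "openin (pos X) V" if "V \<in> biclopens X" for V
    using that by (simp add: biclopens_def)
  show "\<exists>V. V \<in> biclopens X \<and> x \<in> V \<and> V \<subseteq> U" if "openin (pos X) U \<and> x \<in> U" for U x
    using that d_boolean_base[OF assms] by metis
qed

lemma biclopens_Int: "A \<in> biclopens X \<Longrightarrow> B \<in> biclopens X \<Longrightarrow> A \<inter> B \<in> biclopens X"
  and biclopens_Union: "finite \<F> \<Longrightarrow> \<F> \<subseteq> biclopens X \<Longrightarrow> \<Union>\<F> \<in> biclopens X"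
  by (auto simp: biclopens_def intro!: closedin_Union)

text \<open>A compact open set is covered by finitely many of the biclopen sets inside it, and
  finite unions of biclopen sets are biclopen.\<close>

lemma compact_opens_d_boolean:
  assumes X: "d_boolean X"
  shows "compact_opens (pos X) = biclopens X"
proof
  show "biclopens X \<subseteq> compact_opens (pos X)"
    using X biclopens_subset_compact_opens by (auto simp: d_boolean_def)
  show "compact_opens (pos X) \<subseteq> biclopens X"
  proof
    fix U assume U: "U \<in> compact_opens (pos X)"
    define \<B> where "\<B> = {B \<in> biclopens X. B \<subseteq> U}"
    have "U \<subseteq> \<Union>\<B>"
      using d_boolean_base[OF X] U unfolding compact_opens_def \<B>_def by blast
    moreover have "\<forall>B\<in>\<B>. openin (pos X) B"
      by (auto simp: \<B>_def biclopens_def)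
    ultimately obtain \<F> where "finite \<F>" "\<F> \<subseteq> \<B>" "U \<subseteq> \<Union>\<F>"
      using U unfolding compact_opens_def compactin_def by (smt (verit) mem_Collect_eq)
    then have "U = \<Union>\<F>" "\<F> \<subseteq> biclopens X"
      by (auto simp: \<B>_def)
    with \<open>finite \<F>\<close> show "U \<in> biclopens X"
      using biclopens_Union by metis
  qed
qed

lemma d_boolean_coherent:
  assumes "d_boolean X"
  shows "coherent_frame {U. openin (pos X) U}"
  unfolding coherent_frame_opens_iff compact_opens_d_boolean[OF assms]
proof (intro conjI allI impI ballI biclopens_Int)
  have "points X \<in> biclopens X"
    using assms by (metis (mono_tags, lifting) biclopens_def bitop_space_def closedin_topspace
        d_boolean_def mem_Collect_eq openin_topspace)
  then have "points X \<in> compact_opens (pos X)"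
    using compact_opens_d_boolean[OF assms] by blast
  then show "compact_space (pos X)"
    by (simp add: compact_opens_def compact_space_def)
  show "\<exists>K\<in>biclopens X. x \<in> K \<and> K \<subseteq> U" if "openin (pos X) U \<and> x \<in> U" for U x
    using d_boolean_base[OF assms] that by metis
qed

section \<open>Closures of points and d-sobriety\<close>

text \<open>Comparison on a basis suffices. If \<open>x\<close> were outside \<open>K\<close>, a
  basic neighbourhood of \<open>x\<close> would miss \<open>K\<close>. If some point of
  \<open>K\<close> had a neighbourhood without \<open>x\<close>, a basic one inside it would meet
  \<open>K\<close> without containing \<open>x\<close>.\<close>

lemma closure_of_singleton_eqI:
  assumes "closedin T K" "x \<in> topspace T"
    and "\<And>U y. openin T U \<Longrightarrow> y \<in> U \<Longrightarrow> \<exists>B\<in>\<B>. y \<in> B \<and> B \<subseteq> U"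
    and "\<And>B. B \<in> \<B> \<Longrightarrow> openin T B"
    and "\<And>B. B \<in> \<B> \<Longrightarrow> x \<in> B \<longleftrightarrow> K \<inter> B \<noteq> {}"
  shows "K = T closure_of {x}"
proof
  have "x \<in> K"
  proof (rule ccontr)
    assume "x \<notin> K"
    then obtain B where "B \<in> \<B>" "x \<in> B" "B \<subseteq> topspace T - K"
      using assms(1,2) assms(3)[of "topspace T - K" x] by blast
    with assms(5) show False
      by blast
  qed
  then show "T closure_of {x} \<subseteq> K"
    using assms(1) by (simp add: closure_of_minimal)
  show "K \<subseteq> T closure_of {x}"
  proof
    fix y assume y: "y \<in> K"
    have "x \<in> U" if "openin T U" "y \<in> U" for U
      using assms(3)[OF that] assms(5) y by blast
    with y show "y \<in> T closure_of {x}"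
      using closedin_subset[OF assms(1)] by (auto simp: in_closure_of)
  qed
qed

lemma closure_of_singleton_Int:
  assumes "openin T U"
  shows "T closure_of {x} \<inter> U \<noteq> {} \<longleftrightarrow> x \<in> U"
  using openin_Int_closure_of_eq_empty[OF assms, of "{x}"] by (auto simp: Int_commute)

lemma closure_of_singleton_eqD:
  assumes "T closure_of {x} = T closure_of {y}" "openin T U"
  shows "x \<in> U \<longleftrightarrow> y \<in> U"
  using closure_of_singleton_Int[OF assms(2)] assms(1) by metis

text \<open>Points that neither topology tells apart stay inseparable under the finite intersections
  and unions that generate the join.\<close>

lemma t0_join_eqI:
  assumes X: "bitop_space X" "t0_space (join_topology X)" and xy: "x \<in> points X" "y \<in> points X"
    and pos: "\<And>U. openin (pos X) U \<Longrightarrow> x \<in> U \<longleftrightarrow> y \<in> U"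
    and neg: "\<And>U. openin (neg X) U \<Longrightarrow> x \<in> U \<longleftrightarrow> y \<in> U"
  shows "x = y"
proof (rule ccontr)
  assume "x \<noteq> y"
  then obtain W where W: "openin (join_topology X) W" "x \<notin> W \<longleftrightarrow> y \<in> W"
    using X xy topspace_join unfolding t0_space_def by metis
  from W(1) have "generate_topology_on ({U. openin (pos X) U} \<union> {V. openin (neg X) V}) W"
    by (simp add: join_topology_def openin_topology_generated_by_iff)
  then have "x \<in> W \<longleftrightarrow> y \<in> W"
    by induction (use pos neg in auto)
  with W show False
    by blast
qed

text \<open>
  If no point fitted a pair \<open>(K, L)\<close>, the biclopen sets missing \<open>K\<close> and the complements of
  biclopen sets missing \<open>L\<close> would cover the space, contradicting the second condition on \<open>(K, L)\<close>.
\<close>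
lemma d_boolean_d_sober:
  assumes X: "d_boolean X"
  shows "d_sober X"
  unfolding d_sober_def
proof (intro allI impI)
  fix K L
  assume H: "irreducible_closedin (pos X) K \<and> irreducible_closedin (neg X) L \<and>
        (\<forall>U V. openin (pos X) U \<and> openin (neg X) V \<longrightarrow>
           (U \<inter> V = {} \<longrightarrow> K \<inter> U = {} \<or> L \<inter> V = {}) \<and>
           (U \<union> V = points X \<longrightarrow> K \<inter> U \<noteq> {} \<or> L \<inter> V \<noteq> {}))"
  have bi: "bitop_space X" "bitop_space (swap X)" and X': "d_boolean (swap X)"
    using X by (auto simp: d_boolean_def)
  have disj: "K \<inter> U = {} \<or> L \<inter> V = {}"
    if "openin (pos X) U" "openin (neg X) V" "U \<inter> V = {}" for U V
    using H that by blast
  have cover: "K \<inter> U \<noteq> {} \<or> L \<inter> V \<noteq> {}"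
    if "openin (pos X) U" "openin (neg X) V" "U \<union> V = points X" for U V
    using H that by blast
  define U where "U = \<Union>{B \<in> biclopens X. K \<inter> B = {}}"
  define V where "V = \<Union>{B \<in> biclopens (swap X). L \<inter> B = {}}"
  have UV: "openin (pos X) U" "openin (neg X) V" "K \<inter> U = {}" "L \<inter> V = {}"
    by (auto simp: U_def V_def biclopens_def)
  then have "U \<union> V \<subseteq> points X"
    using bi openin_subset unfolding bitop_space_def by blast
  with cover[OF UV(1,2)] UV obtain x where x: "x \<in> points X" "x \<notin> U" "x \<notin> V"
    by blast
  have "x \<in> B \<longleftrightarrow> K \<inter> B \<noteq> {}" if B: "B \<in> biclopens X" for B
  proof
    \<comment> \<open>Here the first condition on \<open>(K, L)\<close> enters: \<open>B\<close> and
      its complement are disjoint and \<open>K\<close> meets \<open>B\<close>, so \<open>L\<close>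
      misses the complement. The complement is then a part of \<open>V\<close>, which
      \<open>x\<close> avoids.\<close>
    assume "K \<inter> B \<noteq> {}"
    moreover have B': "points X - B \<in> biclopens (swap X)"
      using B bi(1) by (auto simp: biclopens_def bitop_space_def closedin_def openin_subset double_diff)
    ultimately have "L \<inter> (points X - B) = {}"
      using disj[of B "points X - B"] B by (auto simp: biclopens_def)
    with B' x show "x \<in> B"
      by (auto simp: V_def)
  qed (use x B in \<open>auto simp: U_def\<close>)
  then have K: "K = pos X closure_of {x}"
    using H x(1) d_boolean_base[OF X]
    by (intro closure_of_singleton_eqI[where \<B> = "biclopens X"])
      (auto simp: irreducible_closedin_def biclopens_def, metis)
  have "x \<in> B \<longleftrightarrow> L \<inter> B \<noteq> {}" if B: "B \<in> biclopens (swap X)" for B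
  proof
    assume "L \<inter> B \<noteq> {}"
    moreover have B': "points X - B \<in> biclopens X"
      using B bi(1) by (auto simp: biclopens_def bitop_space_def closedin_def openin_subset double_diff)
    ultimately have "K \<inter> (points X - B) = {}"
      using disj[of "points X - B" B] B by (auto simp: biclopens_def)
    with B' x show "x \<in> B"
      by (auto simp: U_def)
  qed (use x B in \<open>auto simp: V_def\<close>)
  then have L: "L = neg X closure_of {x}"
    using H x(1) bi(1) d_boolean_base[OF X']
    by (intro closure_of_singleton_eqI[where \<B> = "biclopens (swap X)"])
      (auto simp: irreducible_closedin_def biclopens_def bitop_space_def, metis)
  have "y = x" if y: "y \<in> points X" "K = pos X closure_of {y}" "L = neg X closure_of {y}" for y
  proof (rule t0_join_eqI[OF bi(1) _ y(1) x(1)])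
    show "t0_space (join_topology X)"
      using X by (simp add: d_boolean_def)
    show "y \<in> U \<longleftrightarrow> x \<in> U" if "openin (pos X) U" for U
      using K y(2) that by (intro closure_of_singleton_eqD) simp_all
    show "y \<in> U \<longleftrightarrow> x \<in> U" if "openin (neg X) U" for U
      using L y(3) that by (intro closure_of_singleton_eqD) simp_all
  qed
  with x(1) K L show "\<exists>!x. x \<in> points X \<and> K = pos X closure_of {x} \<and> L = neg X closure_of {x}"
    by blast
qed

lemma d_boolean_d_spectral:
  assumes "d_boolean X"
  shows "d_spectral X"
  using assms d_boolean_d_sober d_boolean_coherent[of X] d_boolean_coherent[of "swap X"]
  by (auto simp: d_spectral_def d_boolean_def)

section \<open>Maps into d-Boolean spaces\<close>

lemma bicontinuous_vimage_biclopens: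
  assumes "bicontinuous X Y f" "bitop_space X" "U \<in> biclopens Y"
  shows "{x \<in> points X. f x \<in> U} \<in> biclopens X"
proof -
  have "openin (pos X) {x \<in> points X. f x \<in> U}"
    using assms by (intro openin_continuous_map_preimage[of _ "pos Y"])
      (auto simp: biclopens_def bicontinuous_def)
  moreover have "closedin (neg X) {x \<in> topspace (neg X). f x \<in> U}"
    using assms by (intro closedin_continuous_map_preimage[of _ "neg Y"])
      (auto simp: biclopens_def bicontinuous_def)
  ultimately show ?thesis
    using assms(2) by (simp add: biclopens_def bitop_space_def)
qed

text \<open>Compact open sets of \<open>Y\<close> are biclopen, biclopen sets pull back to biclopen
  sets, and compactness of \<open>X\<close> makes these compact open again.\<close>

lemma bicontinuous_spectral_map:
  assumes X: "bitop_space X" "compact_space (join_topology X)" and Y: "d_boolean Y"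
    and f: "bicontinuous X Y f"
  shows "spectral_map (pos X) (pos Y) f"
  unfolding spectral_map_def
proof (intro conjI allI impI)
  show "continuous_map (pos X) (pos Y) f"
    using f by (simp add: bicontinuous_def)
  fix U assume "openin (pos Y) U \<and> compactin (pos Y) U"
  then have "U \<in> biclopens Y"
    using compact_opens_d_boolean[OF Y] by (auto simp: compact_opens_def)
  then have "{x \<in> points X. f x \<in> U} \<in> compact_opens (pos X)"
    using bicontinuous_vimage_biclopens biclopens_subset_compact_opens X f by blast
  then show "openin (pos X) {x \<in> points X. f x \<in> U}" "compactin (pos X) {x \<in> points X. f x \<in> U}"
    by (auto simp: compact_opens_def)
qed

lemma d_spectral_map_into_d_boolean:
  assumes X: "bitop_space X" "compact_space (join_topology X)" and Y: "d_boolean Y"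
  shows "d_spectral_map X Y f \<longleftrightarrow> bicontinuous X Y f"
proof
  show "bicontinuous X Y f" if "d_spectral_map X Y f"
    using that by (auto simp: d_spectral_map_def spectral_map_def bicontinuous_def)
  show "d_spectral_map X Y f" if "bicontinuous X Y f"
    unfolding d_spectral_map_def
    using bicontinuous_spectral_map[of X Y f] bicontinuous_spectral_map[of "swap X" "swap Y" f]
      assms that by simp
qed

section \<open>Bitopological spaces generated by complemented subbases\<close>

text \<open>Makes the members of \<open>\<P>\<close> biclopen by construction. The point set of a
  generated topology is the union of its subbase; inserting \<open>S\<close> fixes it to be
  \<open>S\<close> on both sides even if \<open>\<P>\<close> or the complements fail to
  cover.\<close>

definition bool_bitop :: "'a set \<Rightarrow> 'a set set \<Rightarrow> 'a bitop" where
  "bool_bitop S \<P> = Bitop (topology_generated_by (insert S \<P>))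
     (topology_generated_by (insert S ((-) S ` \<P>)))"

lemma points_bool_bitop:
  assumes "\<P> \<subseteq> Pow S"
  shows "points (bool_bitop S \<P>) = S" "topspace (neg (bool_bitop S \<P>)) = S"
  using assms by (auto simp: bool_bitop_def)

lemma bitop_space_bool_bitop: "\<P> \<subseteq> Pow S \<Longrightarrow> bitop_space (bool_bitop S \<P>)"
  by (simp add: bitop_space_def points_bool_bitop)

lemma subbase_biclopens:
  assumes "\<P> \<subseteq> Pow S" "U \<in> \<P>"
  shows "U \<in> biclopens (bool_bitop S \<P>)"
  using assms topology_generated_by_Basis[of U "insert S \<P>"]
    topology_generated_by_Basis[of "S - U" "insert S ((-) S ` \<P>)"] points_bool_bitop[OF assms(1)]
  unfolding biclopens_def bool_bitop_def by (auto simp: closedin_def)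

text \<open>Finite intersections of subbasic sets form a basis and remain \<open>T\<close>-closed.
  In the induction a union needs only the member that contains the given point.\<close>

lemma has_basis_of_closed_generated:
  assumes "\<And>U. U \<in> \<P> \<Longrightarrow> closedin T U"
  shows "has_basis_of_closed (topology_generated_by \<P>) T"
  unfolding has_basis_of_closed_iff
proof (intro allI impI, elim conjE)
  fix U x assume "openin (topology_generated_by \<P>) U" and x: "x \<in> U"
  then have "generate_topology_on \<P> U"
    by (simp add: openin_topology_generated_by_iff)
  then show "\<exists>B. openin (topology_generated_by \<P>) B \<and> closedin T B \<and> x \<in> B \<and> B \<subseteq> U"
    using x
  proof (induction arbitrary: x)
    case Empty
    then show ?case by simp
  next
    case (Int a b)
    then obtain A B where "openin (topology_generated_by \<P>) A" "closedin T A" "x \<in> A" "A \<subseteq> a"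
      "openin (topology_generated_by \<P>) B" "closedin T B" "x \<in> B" "B \<subseteq> b"
      by (metis IntE)
    then show ?case
      by (intro exI[of _ "A \<inter> B"]) auto
  next
    case (UN K)
    then show ?case
      by (metis Union_iff Union_upper subset_trans)
  next
    case (Basis s)
    then show ?case
      using assms topology_generated_by_Basis by (metis subset_refl)
  qed
qed

lemma zero_dimensional_bool_bitop:
  assumes "\<P> \<subseteq> Pow S"
  shows "zero_dimensional (bool_bitop S \<P>)"
proof -
  have "closedin (neg (bool_bitop S \<P>)) U" if "U \<in> insert S \<P>" for U
    using that subbase_biclopens[OF assms, of U] points_bool_bitop[OF assms]
    by (metis (no_types, lifting) biclopens_def closedin_topspace insertE mem_Collect_eq)
  moreover have "closedin (pos (bool_bitop S \<P>)) U" if U: "U \<in> insert S ((-) S ` \<P>)" for U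
  proof (cases "U = S")
    case True
    then show ?thesis
      using points_bool_bitop[OF assms] by (metis closedin_topspace)
  next
    case False
    with U obtain V where "V \<in> \<P>" "U = S - V"
      by auto
    then show ?thesis
      using subbase_biclopens[OF assms, of V] points_bool_bitop[OF assms]
      by (auto simp: biclopens_def closedin_def double_diff openin_subset)
  qed
  ultimately show ?thesis
    unfolding zero_dimensional_def bool_bitop_def bitop.sel
    by (intro conjI has_basis_of_closed_generated) blast+
qed

text \<open>Continuity is tested on the two subbases. The preimage of a complement is the complement
  of the preimage, so the two tests for one \<open>U\<close> combine into a single biclopenness
  condition.\<close>

lemma bicontinuous_bool_bitop:
  assumes \<P>: "\<P> \<subseteq> Pow S" and X: "bitop_space X"
  shows "bicontinuous X (bool_bitop S \<P>) f \<longleftrightarrow>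
     f ` points X \<subseteq> S \<and> (\<forall>U\<in>\<P>. {x \<in> points X. f x \<in> U} \<in> biclopens X)"
proof
  assume f: "bicontinuous X (bool_bitop S \<P>) f"
  then have "f ` points X \<subseteq> S"
    using points_bool_bitop[OF \<P>] continuous_map_image_subset_topspace
    unfolding bicontinuous_def by metis
  with f show "f ` points X \<subseteq> S \<and> (\<forall>U\<in>\<P>. {x \<in> points X. f x \<in> U} \<in> biclopens X)"
    using bicontinuous_vimage_biclopens[OF f X] subbase_biclopens[OF \<P>] by blast
next
  assume "f ` points X \<subseteq> S \<and> (\<forall>U\<in>\<P>. {x \<in> points X. f x \<in> U} \<in> biclopens X)"
  then have f: "f ` points X \<subseteq> S"
    and pre: "\<And>U. U \<in> \<P> \<Longrightarrow> f -` U \<inter> points X \<in> biclopens X"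
    by (auto simp: vimage_def Int_def conj_commute)
  have S: "f -` S \<inter> points X = points X"
    using f by auto
  have compl: "f -` (S - U) \<inter> points X = points X - (f -` U \<inter> points X)" for U
    using f by auto
  have "continuous_map (pos X) (pos (bool_bitop S \<P>)) f"
    unfolding bool_bitop_def bitop.sel
    by (rule continuous_on_generated_topo) (use f S pre in \<open>auto simp: biclopens_def\<close>)
  moreover have "continuous_map (neg X) (neg (bool_bitop S \<P>)) f"
    unfolding bool_bitop_def bitop.sel
  proof (rule continuous_on_generated_topo)
    show "f ` topspace (neg X) \<subseteq> \<Union> (insert S ((-) S ` \<P>))"
      using f X by (auto simp: bitop_space_def)
    fix U assume "U \<in> insert S ((-) S ` \<P>)"
    then show "openin (neg X) (f -` U \<inter> topspace (neg X))"
      using S compl pre X by (auto simp: biclopens_def closedin_def bitop_space_def)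
  qed
  ultimately show "bicontinuous X (bool_bitop S \<P>) f"
    by (simp add: bicontinuous_def)
qed

lemma t0_space_bool_bitop:
  assumes \<P>: "\<P> \<subseteq> Pow S"
    and sep: "\<And>x y. x \<in> S \<Longrightarrow> y \<in> S \<Longrightarrow> x \<noteq> y \<Longrightarrow> \<exists>U\<in>\<P>. x \<in> U \<longleftrightarrow> y \<notin> U"
  shows "t0_space (join_topology (bool_bitop S \<P>))"
proof -
  have "openin (join_topology (bool_bitop S \<P>)) U" if "U \<in> \<P>" for U
    using subbase_biclopens[OF \<P> that] by (simp add: biclopens_def openin_join_pos)
  with sep show ?thesis
    unfolding t0_space_def topspace_join[OF bitop_space_bool_bitop[OF \<P>]] points_bool_bitop[OF \<P>]
    by blast
qed

section \<open>Prime ideals of sets and compactness\<close>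

text \<open>Ideals suit open covers better than filters: a cover without a finite subcover generates
  a proper ideal. Closure under unions of finite families includes the empty family, so
  \<open>{}\<close> is always a member.\<close>

definition prime_ideal_on :: "'a set \<Rightarrow> 'a set set \<Rightarrow> bool" where
  "prime_ideal_on S N \<longleftrightarrow> N \<subseteq> Pow S \<and> S \<notin> N \<and>
     (\<forall>\<F>. finite \<F> \<and> \<F> \<subseteq> N \<longrightarrow> \<Union>\<F> \<in> N) \<and>
     (\<forall>A B. A \<subseteq> B \<and> B \<in> N \<longrightarrow> A \<in> N) \<and>
     (\<forall>A B. A \<subseteq> S \<and> B \<subseteq> S \<and> A \<inter> B \<in> N \<longrightarrow> A \<in> N \<or> B \<in> N)"

lemma prime_ideal_onD:
  assumes "prime_ideal_on S N"
  shows "A \<in> N \<Longrightarrow> A \<subseteq> S" "S \<notin> N" "finite \<F> \<Longrightarrow> \<F> \<subseteq> N \<Longrightarrow> \<Union>\<F> \<in> N"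
    "A \<subseteq> B \<Longrightarrow> B \<in> N \<Longrightarrow> A \<in> N"
    "A \<subseteq> S \<Longrightarrow> B \<subseteq> S \<Longrightarrow> A \<inter> B \<in> N \<Longrightarrow> A \<in> N \<or> B \<in> N"
proof -
  note N = assms[unfolded prime_ideal_on_def]
  show "A \<in> N \<Longrightarrow> A \<subseteq> S"
    using N[THEN conjunct1] by blast
  show "S \<notin> N"
    using N by (elim conjE)
  show "\<Union>\<F> \<in> N" if "finite \<F>" "\<F> \<subseteq> N"
    using N[THEN conjunct2, THEN conjunct2, THEN conjunct1] that by blast
  show "A \<in> N" if "A \<subseteq> B" "B \<in> N"
    using N[THEN conjunct2, THEN conjunct2, THEN conjunct2, THEN conjunct1] that by blast
  show "A \<in> N \<or> B \<in> N" if "A \<subseteq> S" "B \<subseteq> S" "A \<inter> B \<in> N"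
    using N[THEN conjunct2, THEN conjunct2, THEN conjunct2, THEN conjunct2] that by blast
qed

lemma prime_ideal_on_compl:
  assumes N: "prime_ideal_on S N" and A: "A \<subseteq> S"
  shows "S - A \<in> N \<longleftrightarrow> A \<notin> N"
proof
  assume "S - A \<in> N"
  then have "A \<in> N \<Longrightarrow> \<Union>{A, S - A} \<in> N"
    by (intro prime_ideal_onD(3)[OF N]) auto
  moreover have "\<Union>{A, S - A} = S"
    using A by auto
  ultimately show "A \<notin> N"
    using prime_ideal_onD(2)[OF N] by auto
next
  assume "A \<notin> N"
  moreover have "A \<inter> (S - A) \<in> N"
    using prime_ideal_onD(3)[OF N, of "{}"] by simp
  ultimately show "S - A \<in> N"
    using prime_ideal_onD(5)[OF N A Diff_subset] by blast
qed

text \<open>Zorn's lemma is applied to the families that extend \<open>\<C>\<close> and have no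
  finite subcover of \<open>S\<close>; a finite part of the union of a chain already lies in one
  member of the chain. The ideal laws and primeness of a maximal family all follow by combining
  finite covers into a forbidden one.\<close>

lemma prime_ideal_on_exists:
  assumes \<C>: "\<C> \<subseteq> Pow S" and fin: "\<And>\<F>. finite \<F> \<Longrightarrow> \<F> \<subseteq> \<C> \<Longrightarrow> \<Union>\<F> \<noteq> S"
  obtains N where "prime_ideal_on S N" "\<C> \<subseteq> N"
proof -
  define \<A> where "\<A> = {N. \<C> \<subseteq> N \<and> N \<subseteq> Pow S \<and> (\<forall>\<F>. finite \<F> \<and> \<F> \<subseteq> N \<longrightarrow> \<Union>\<F> \<noteq> S)}"
  have "\<C> \<in> \<A>"
    using \<C> fin by (auto simp: \<A>_def)
  moreover have "\<Union>\<K> \<in> \<A>" if \<K>: "\<K> \<noteq> {}" "subset.chain \<A> \<K>" for \<K>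
  proof -
    have sub: "\<K> \<subseteq> \<A>"
      using \<K>(2) by (simp add: subset.chain_def)
    then have bounds: "\<C> \<subseteq> N" "N \<subseteq> Pow S" if "N \<in> \<K>" for N
      using that by (auto simp: \<A>_def)
    have "\<Union>\<F> \<noteq> S" if \<F>: "finite \<F>" "\<F> \<subseteq> \<Union>\<K>" for \<F>
    proof -
      obtain N where "N \<in> \<K>" "\<F> \<subseteq> N"
        using finite_subset_Union_chain[OF \<F> \<K>] by blast
      with sub \<F>(1) show ?thesis
        unfolding \<A>_def by blast
    qed
    moreover have "\<C> \<subseteq> \<Union>\<K>" "\<Union>\<K> \<subseteq> Pow S"
      using \<K>(1) bounds by blast+
    ultimately show ?thesis
      by (simp add: \<A>_def)
  qed
  ultimately obtain M where "M \<in> \<A>" and max: "\<And>N. N \<in> \<A> \<Longrightarrow> M \<subseteq> N \<Longrightarrow> N = M"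
    using subset_Zorn_nonempty[of \<A>] by blast
  then have M: "\<C> \<subseteq> M" "M \<subseteq> Pow S" "\<And>\<F>. finite \<F> \<Longrightarrow> \<F> \<subseteq> M \<Longrightarrow> \<Union>\<F> \<noteq> S"
    by (auto simp: \<A>_def)
  \<comment> \<open>Maximality in usable form: adding \<open>A\<close> creates a finite cover of
    \<open>S\<close>, from which \<open>A\<close> itself is split off.\<close>
  have cover: "\<exists>\<F>. finite \<F> \<and> \<F> \<subseteq> M \<and> A \<union> \<Union>\<F> = S" if A: "A \<subseteq> S" "A \<notin> M" for A
  proof -
    have "insert A M \<notin> \<A>"
      using max[of "insert A M"] A(2) by blast
    moreover have "\<C> \<subseteq> insert A M" "insert A M \<subseteq> Pow S"
      using M(1,2) A(1) by auto
    ultimately have "\<not> (\<forall>\<F>. finite \<F> \<and> \<F> \<subseteq> insert A M \<longrightarrow> \<Union>\<F> \<noteq> S)"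
      unfolding \<A>_def by blast
    then obtain \<F> where \<F>: "finite \<F>" "\<F> \<subseteq> insert A M" "\<Union>\<F> = S"
      by auto
    have "\<F> - {A} \<subseteq> M" "A \<union> \<Union>(\<F> - {A}) = S"
      using \<F>(2,3) A(1) by auto
    with \<F>(1) show ?thesis
      by (intro exI[of _ "\<F> - {A}"]) simp
  qed
  have union: "\<Union>\<F> \<in> M" if \<F>: "finite \<F>" "\<F> \<subseteq> M" for \<F>
  proof (rule ccontr)
    assume "\<Union>\<F> \<notin> M"
    moreover have "\<Union>\<F> \<subseteq> S"
      using \<F>(2) M(2) by blast
    ultimately obtain \<G> where "finite \<G>" "\<G> \<subseteq> M" "\<Union>\<F> \<union> \<Union>\<G> = S"
      using cover by metis
    with \<F> M(3)[of "\<F> \<union> \<G>"] show False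
      by simp
  qed
  have down: "A \<in> M" if A: "A \<subseteq> B" "B \<in> M" for A B
  proof (rule ccontr)
    assume "A \<notin> M"
    moreover have "B \<subseteq> S"
      using A(2) M(2) by blast
    ultimately obtain \<F> where \<F>: "finite \<F>" "\<F> \<subseteq> M" "A \<union> \<Union>\<F> = S"
      using cover A(1) by (metis subset_trans)
    then have "\<Union>(insert B \<F>) = S"
      using \<open>B \<subseteq> S\<close> A(1) by auto
    with \<F> A(2) M(3)[of "insert B \<F>"] show False
      by simp
  qed
  have prime: "A \<in> M \<or> B \<in> M" if AB: "A \<subseteq> S" "B \<subseteq> S" "A \<inter> B \<in> M" for A B
  proof (rule ccontr)
    assume "\<not> (A \<in> M \<or> B \<in> M)"
    then obtain \<F> \<G> where \<F>: "finite \<F>" "\<F> \<subseteq> M" "A \<union> \<Union>\<F> = S"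
      and \<G>: "finite \<G>" "\<G> \<subseteq> M" "B \<union> \<Union>\<G> = S"
      using cover AB(1,2) by metis
    \<comment> \<open>A point missed by both \<open>\<Union>\<F>\<close> and
      \<open>\<Union>\<G>\<close> lies in \<open>A\<close> and in \<open>B\<close>.\<close>
    then have "\<Union>(insert (A \<inter> B) (\<F> \<union> \<G>)) = S"
      by auto
    with \<F> \<G> AB(3) M(3)[of "insert (A \<inter> B) (\<F> \<union> \<G>)"] show False
      by simp
  qed
  have "prime_ideal_on S M"
    unfolding prime_ideal_on_def
  proof (intro conjI allI impI)
    show "S \<notin> M"
      using M(3)[of "{S}"] by auto
    show "\<Union>\<F> \<in> M" if "finite \<F> \<and> \<F> \<subseteq> M" for \<F>
      using that union by simp
    show "A \<in> M" if "A \<subseteq> B \<and> B \<in> M" for A B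
      using that down by (elim conjE)
    show "A \<in> M \<or> B \<in> M" if "A \<subseteq> S \<and> B \<subseteq> S \<and> A \<inter> B \<in> M" for A B
      using that prime by (elim conjE)
  qed (fact M(2))
  then show thesis
    using M(1) by (rule that)
qed

text \<open>In terms of the ultrafilter of sets outside \<open>N\<close>, this says that convergence
  to \<open>x\<close> may be tested on a subbase. Intersections use primeness and unions use
  downward closure; \<open>W \<subseteq> S\<close> is carried along because primeness speaks of
  subsets of \<open>S\<close> only.\<close>

lemma generated_open_notin_prime_ideal:
  assumes N: "prime_ideal_on S N" and Q: "\<And>U. U \<in> \<Q> \<Longrightarrow> U \<subseteq> S \<and> (x \<in> U \<longrightarrow> U \<notin> N)"
    and W: "openin (topology_generated_by \<Q>) W"
  shows "W \<subseteq> S \<and> (x \<in> W \<longrightarrow> W \<notin> N)"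
proof -
  have "generate_topology_on \<Q> W"
    using W by (simp add: openin_topology_generated_by_iff)
  then show ?thesis
  proof induction
    case (Int a b)
    then show ?case
      using prime_ideal_onD(5)[OF N, of a b] by blast
  next
    case (UN K)
    then show ?case
      by (metis Union_iff Union_least Union_upper prime_ideal_onD(4)[OF N])
  qed (use Q in auto)
qed

text \<open>A cover without a finite subcover would extend to a prime ideal \<open>N\<close>. The
  point \<open>x\<close> assigned to \<open>N\<close> lies in some member of the cover, which
  belongs to \<open>N\<close>, although no open neighbourhood of \<open>x\<close> does.\<close>

lemma compact_space_join_bool_bitop:
  assumes \<P>: "\<P> \<subseteq> Pow S"
    and pt: "\<And>N. prime_ideal_on S N \<Longrightarrow> \<exists>x\<in>S. \<forall>U\<in>\<P>. x \<in> U \<longleftrightarrow> U \<notin> N"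
  shows "compact_space (join_topology (bool_bitop S \<P>))"
proof -
  let ?X = "bool_bitop S \<P>"
  have top: "topspace (join_topology ?X) = S"
    using topspace_join[OF bitop_space_bool_bitop[OF \<P>]] points_bool_bitop[OF \<P>] by simp
  have "\<exists>\<F>. finite \<F> \<and> \<F> \<subseteq> \<C> \<and> \<Union>\<F> = S"
    if \<C>: "\<forall>U\<in>\<C>. openin (join_topology ?X) U" "\<Union>\<C> = S" for \<C>
  proof (rule ccontr)
    assume "\<nexists>\<F>. finite \<F> \<and> \<F> \<subseteq> \<C> \<and> \<Union>\<F> = S"
    then have "\<Union>\<F> \<noteq> S" if "finite \<F>" "\<F> \<subseteq> \<C>" for \<F>
      using that by blast
    moreover have "\<C> \<subseteq> Pow S"
      using \<C>(2) by blast
    ultimately obtain N where N: "prime_ideal_on S N" "\<C> \<subseteq> N"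
      using prime_ideal_on_exists by metis
    obtain x where x: "x \<in> S" "\<And>U. U \<in> \<P> \<Longrightarrow> x \<in> U \<longleftrightarrow> U \<notin> N"
      using pt[OF N(1)] by auto
    have pos: "W \<subseteq> S \<and> (x \<in> W \<longrightarrow> W \<notin> N)" if "openin (pos ?X) W" for W
      using that unfolding bool_bitop_def bitop.sel
    proof (rule generated_open_notin_prime_ideal[OF N(1), rotated])
      fix U assume "U \<in> insert S \<P>"
      then show "U \<subseteq> S \<and> (x \<in> U \<longrightarrow> U \<notin> N)"
        using x \<P> prime_ideal_onD(2)[OF N(1)] by auto
    qed
    have neg: "W \<subseteq> S \<and> (x \<in> W \<longrightarrow> W \<notin> N)" if "openin (neg ?X) W" for W
      using that unfolding bool_bitop_def bitop.sel
    proof (rule generated_open_notin_prime_ideal[OF N(1), rotated])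
      fix U assume "U \<in> insert S ((-) S ` \<P>)"
      then consider "U = S" | V where "V \<in> \<P>" "U = S - V"
        by blast
      then show "U \<subseteq> S \<and> (x \<in> U \<longrightarrow> U \<notin> N)"
      proof cases
        case 1
        then show ?thesis
          using prime_ideal_onD(2)[OF N(1)] by simp
      next
        case 2
        moreover have "V \<subseteq> S"
          using 2 \<P> by blast
        ultimately show ?thesis
          using x prime_ideal_on_compl[OF N(1), of V] by auto
      qed
    qed
    \<comment> \<open>The join is generated by the open sets of both topologies, so the subbase
      argument applies once more with these as subbase.\<close>
    have "x \<in> W \<longrightarrow> W \<notin> N" if "openin (join_topology ?X) W" for W
      by (rule generated_open_notin_prime_ideal[OF N(1) _ that[unfolded join_topology_def],
            THEN conjunct2]) (use pos neg in auto)
    moreover obtain W where "W \<in> \<C>" "x \<in> W"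
      using x(1) \<C>(2) by blast
    ultimately show False
      using \<C>(1) N(2) by blast
  qed
  then show ?thesis
    unfolding compact_space top by simp
qed

section \<open>The coreflection\<close>

text \<open>The complements taken for the second topology turn the sets contributed by
  \<open>neg X\<close> back into its compact open sets, so one family encodes both refinements. This
  is a two-sided form of the patch (constructible) topology.\<close>

definition patch :: "'a bitop \<Rightarrow> 'a bitop" where
  "patch X = bool_bitop (points X)
     (compact_opens (pos X) \<union> (-) (points X) ` compact_opens (neg X))"

lemma patch_subbase:
  "compact_opens (pos X) \<union> (-) (points X) ` compact_opens (neg X) \<subseteq> Pow (points X)"
  using compact_opens_subset[of _ "pos X"] by blast

lemma points_patch [simp]: "points (patch X) = points X"
  unfolding patch_def by (rule points_bool_bitop(1)[OF patch_subbase])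

lemma coherent_base:
  assumes "coherent_frame {U. openin T U}" "openin T U" "x \<in> U"
  obtains K where "K \<in> compact_opens T" "x \<in> K" "K \<subseteq> U"
  using assms unfolding coherent_frame_opens_iff by metis

text \<open>If \<open>K\<close> misses a compact open \<open>U\<close>, then \<open>U\<close> is
  covered by compact open members of \<open>N\<close>, by compactness by finitely many of them, and
  so belongs to \<open>N\<close>. Primeness of \<open>N\<close> then becomes irreducibility of
  \<open>K\<close>; nonemptiness holds because the whole space is compact open and outside
  \<open>N\<close>.\<close>

lemma prime_ideal_irreducible_closed:
  assumes T: "coherent_frame {U. openin T U}" and N: "prime_ideal_on (topspace T) N"
    and K: "K = topspace T - \<Union>(compact_opens T \<inter> N)"
  shows "irreducible_closedin T K" "\<And>U. U \<in> compact_opens T \<Longrightarrow> K \<inter> U \<noteq> {} \<longleftrightarrow> U \<notin> N"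
proof -
  show meets: "K \<inter> U \<noteq> {} \<longleftrightarrow> U \<notin> N" if U: "U \<in> compact_opens T" for U
  proof
    show "U \<notin> N" if "K \<inter> U \<noteq> {}"
      using that U K by blast
    show "K \<inter> U \<noteq> {}" if "U \<notin> N"
    proof
      assume "K \<inter> U = {}"
      then have "U \<subseteq> \<Union>(compact_opens T \<inter> N)"
        using U K openin_subset unfolding compact_opens_def by blast
      moreover have "\<forall>V\<in>compact_opens T \<inter> N. openin T V"
        by (simp add: compact_opens_def)
      ultimately obtain \<F> where "finite \<F>" "\<F> \<subseteq> compact_opens T \<inter> N" "U \<subseteq> \<Union>\<F>"
        using U unfolding compact_opens_def compactin_def by (smt (verit) mem_Collect_eq)
      then have "U \<in> N"
        using prime_ideal_onD(3,4)[OF N] by (metis le_inf_iff)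
      with \<open>U \<notin> N\<close> show False ..
    qed
  qed
  show "irreducible_closedin T K"
    unfolding irreducible_closedin_def
  proof (intro conjI allI impI)
    show "closedin T K"
      unfolding K by (intro closedin_diff) (auto simp: compact_opens_def)
    have "topspace T \<in> compact_opens T"
      using T by (simp add: coherent_frame_opens_iff compact_opens_def compact_space_def)
    then show "K \<noteq> {}"
      using meets prime_ideal_onD(2)[OF N] by blast
    fix A B assume AB: "closedin T A \<and> closedin T B \<and> K = A \<union> B"
    show "K = A \<or> K = B"
    proof (rule ccontr)
      assume "\<not> (K = A \<or> K = B)"
      \<comment> \<open>Compact open neighbourhoods \<open>U\<close> of \<open>a\<close> avoiding
        \<open>A\<close> and \<open>V\<close> of \<open>b\<close> avoiding \<open>B\<close> both
        meet \<open>K\<close>. By primeness so does \<open>U \<inter> V\<close>, yet this set avoids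
        \<open>A \<union> B\<close>.\<close>
      with AB obtain a b where a: "a \<in> K" "a \<notin> A" and b: "b \<in> K" "b \<notin> B"
        by blast
      have "a \<in> topspace T - A" "b \<in> topspace T - B"
        using a b K by auto
      moreover have "openin T (topspace T - A)" "openin T (topspace T - B)"
        using AB by auto
      ultimately obtain U V where U: "U \<in> compact_opens T" "a \<in> U" "U \<subseteq> topspace T - A"
        and V: "V \<in> compact_opens T" "b \<in> V" "V \<subseteq> topspace T - B"
        using coherent_base[OF T] by metis
      have "U \<notin> N" "V \<notin> N"
        using meets U V a b by blast+
      then have "U \<inter> V \<notin> N"
        using prime_ideal_onD(5)[OF N, of U V] U V by blast
      moreover have "U \<inter> V \<in> compact_opens T"
        using T U V by (simp add: coherent_frame_opens_iff)
      ultimately have "K \<inter> (U \<inter> V) \<noteq> {}"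
        using meets by blast
      with AB U V show False
        by blast
    qed
  qed
qed

text \<open>The ideal yields one irreducible closed set per topology. Primeness of \<open>N\<close>
  gives the first condition of d-sobriety, compactness of the join the second, and the resulting
  point belongs to exactly those compact open sets that are not in \<open>N\<close>.\<close>

lemma prime_ideal_point:
  assumes X: "d_spectral X" and N: "prime_ideal_on (points X) N"
  obtains x where "x \<in> points X" "\<And>U. U \<in> compact_opens (pos X) \<Longrightarrow> x \<in> U \<longleftrightarrow> U \<notin> N"
    "\<And>U. U \<in> compact_opens (neg X) \<Longrightarrow> x \<in> U \<longleftrightarrow> U \<notin> N"
proof -
  have bi: "points X = topspace (neg X)" and coh: "coherent_frame {U. openin (pos X) U}"
    "coherent_frame {U. openin (neg X) U}" and sober: "d_sober X"
    using X by (auto simp: d_spectral_def bitop_space_def)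
  define K where "K = points X - \<Union>(compact_opens (pos X) \<inter> N)"
  define L where "L = topspace (neg X) - \<Union>(compact_opens (neg X) \<inter> N)"
  note K = prime_ideal_irreducible_closed[OF coh(1) N K_def]
  note L = prime_ideal_irreducible_closed[OF coh(2) N[unfolded bi] L_def]
  have disj: "K \<inter> U = {} \<or> L \<inter> V = {}"
    if UV: "openin (pos X) U" "openin (neg X) V" "U \<inter> V = {}" for U V
  proof (rule ccontr)
    assume "\<not> (K \<inter> U = {} \<or> L \<inter> V = {})"
    then obtain a b where "a \<in> K \<inter> U" "b \<in> L \<inter> V"
      by blast
    then obtain A B where A: "A \<in> compact_opens (pos X)" "a \<in> A" "A \<subseteq> U" "a \<in> K"
      and B: "B \<in> compact_opens (neg X)" "b \<in> B" "B \<subseteq> V" "b \<in> L"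
      using coherent_base[OF coh(1) UV(1), of a] coherent_base[OF coh(2) UV(2), of b] by (metis IntE)
    \<comment> \<open>Two sets outside \<open>N\<close> cannot have an empty intersection, since
      \<open>{}\<close> is in \<open>N\<close>.\<close>
    have "A \<notin> N" "B \<notin> N"
      using K(2)[OF A(1)] L(2)[OF B(1)] A B by blast+
    moreover have "A \<subseteq> points X" "B \<subseteq> points X"
      using compact_opens_subset[OF A(1)] compact_opens_subset[OF B(1)] bi by simp_all
    moreover have "A \<inter> B = {}"
      using A B UV(3) by blast
    ultimately show False
      using prime_ideal_onD(5)[OF N, of A B] prime_ideal_onD(3)[OF N, of "{}"] by simp
  qed
  have cover: "K \<inter> U \<noteq> {} \<or> L \<inter> V \<noteq> {}"
    if UV: "openin (pos X) U" "openin (neg X) V" "U \<union> V = points X" for U V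
  proof (rule ccontr)
    assume "\<not> (K \<inter> U \<noteq> {} \<or> L \<inter> V \<noteq> {})"
    then have UV': "K \<inter> U = {}" "L \<inter> V = {}"
      by simp_all
    \<comment> \<open>What \<open>K\<close> and \<open>L\<close> leave out is covered by compact
      open members of \<open>N\<close>. If \<open>U\<close> and \<open>V\<close> covered the space,
      finitely many members of \<open>N\<close> would too, putting the whole space into
      \<open>N\<close>.\<close>
    define \<C> where "\<C> = (compact_opens (pos X) \<inter> N) \<union> (compact_opens (neg X) \<inter> N)"
    have "U \<subseteq> \<Union>\<C>"
      using UV'(1) openin_subset[OF UV(1)] unfolding \<C>_def K_def by blast
    moreover have "V \<subseteq> \<Union>\<C>"
      using UV'(2) openin_subset[OF UV(2)] unfolding \<C>_def L_def by blast
    ultimately have cover: "points X \<subseteq> \<Union>\<C>"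
      using UV(3) by blast
    have \<C>N: "\<C> \<subseteq> N"
      by (auto simp: \<C>_def)
    then have "\<Union>\<C> \<subseteq> points X"
      using prime_ideal_onD(1)[OF N] by blast
    with cover have "\<Union>\<C> = points X"
      by simp
    moreover have "\<forall>W\<in>\<C>. openin (join_topology X) W"
      using openin_join_pos[of X] openin_join_neg[of X] by (auto simp: \<C>_def compact_opens_def)
    moreover have "compact_space (join_topology X)" "topspace (join_topology X) = points X"
      using X topspace_join by (auto simp: d_spectral_def)
    ultimately obtain \<F> where "finite \<F>" "\<F> \<subseteq> \<C>" "\<Union>\<F> = points X"
      unfolding compact_space by metis
    then show False
      using prime_ideal_onD(3)[OF N, of \<F>] prime_ideal_onD(2)[OF N] subset_trans[OF _ \<C>N, of \<F>]
      by simp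
  qed
  have "\<exists>!x. x \<in> points X \<and> K = pos X closure_of {x} \<and> L = neg X closure_of {x}"
  proof (rule sober[unfolded d_sober_def, rule_format], intro conjI allI impI K(1) L(1))
    fix U V assume "openin (pos X) U \<and> openin (neg X) V"
    then have UV: "openin (pos X) U" "openin (neg X) V"
      by simp_all
    show "U \<inter> V = {} \<Longrightarrow> K \<inter> U = {} \<or> L \<inter> V = {}"
      by (rule disj[OF UV])
    show "U \<union> V = points X \<Longrightarrow> K \<inter> U \<noteq> {} \<or> L \<inter> V \<noteq> {}"
      by (rule cover[OF UV])
  qed
  then obtain x where x: "x \<in> points X" "K = pos X closure_of {x}" "L = neg X closure_of {x}"
    by (elim ex1E conjE)
  have "x \<in> U \<longleftrightarrow> U \<notin> N" if "U \<in> compact_opens (pos X)" for U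
    using K(2)[OF that] closure_of_singleton_Int[of "pos X" U x] that x(2)
    by (simp add: compact_opens_def)
  moreover have "x \<in> U \<longleftrightarrow> U \<notin> N" if "U \<in> compact_opens (neg X)" for U
    using L(2)[OF that] closure_of_singleton_Int[of "neg X" U x] that x(3)
    by (simp add: compact_opens_def)
  ultimately show thesis
    by (rule that[OF x(1)])
qed

lemma irreducible_closedin_closure_of_singleton:
  assumes "x \<in> topspace T"
  shows "irreducible_closedin T (T closure_of {x})"
  unfolding irreducible_closedin_def
proof (intro conjI allI impI)
  have x: "x \<in> T closure_of {x}"
    using assms by (simp add: in_closure_of)
  then show "T closure_of {x} \<noteq> {}"
    by blast
  fix A B assume AB: "closedin T A \<and> closedin T B \<and> T closure_of {x} = A \<union> B"
  have "T closure_of {x} \<subseteq> C" if "closedin T C" "x \<in> C" for C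
    using that by (simp add: closure_of_minimal)
  with AB x show "T closure_of {x} = A \<or> T closure_of {x} = B"
    by blast
qed simp

lemma closure_of_singleton_cong:
  assumes "coherent_frame {U. openin T U}" "\<And>U. U \<in> compact_opens T \<Longrightarrow> x \<in> U \<longleftrightarrow> y \<in> U"
  shows "T closure_of {x} = T closure_of {y}"
proof -
  have "x \<in> U \<longleftrightarrow> y \<in> U" if "openin T U" for U
    using coherent_base[OF assms(1) that] assms(2) by (metis subsetD)
  then show ?thesis
    unfolding closure_of_def by auto
qed

text \<open>The uniqueness half of d-sobriety, applied to the closures of \<open>x\<close>: compact
  open sets form bases, so \<open>y\<close> has the same two closures.\<close>

lemma d_spectral_point_eqI:
  assumes X: "d_spectral X" and xy: "x \<in> points X" "y \<in> points X"
    and pos: "\<And>U. U \<in> compact_opens (pos X) \<Longrightarrow> x \<in> U \<longleftrightarrow> y \<in> U"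
    and neg: "\<And>U. U \<in> compact_opens (neg X) \<Longrightarrow> x \<in> U \<longleftrightarrow> y \<in> U"
  shows "x = y"
proof -
  have bi: "points X = topspace (neg X)" and coh: "coherent_frame {U. openin (pos X) U}"
    "coherent_frame {U. openin (neg X) U}" and sober: "d_sober X"
    using X by (auto simp: d_spectral_def bitop_space_def)
  have "pos X closure_of {x} = pos X closure_of {y}" "neg X closure_of {x} = neg X closure_of {y}"
    using closure_of_singleton_cong[OF coh(1) pos] closure_of_singleton_cong[OF coh(2) neg] by auto
  moreover have "\<exists>!z. z \<in> points X \<and> pos X closure_of {x} = pos X closure_of {z} \<and>
      neg X closure_of {x} = neg X closure_of {z}"
  proof (rule sober[unfolded d_sober_def, rule_format], intro conjI allI impI)
    show "irreducible_closedin (pos X) (pos X closure_of {x})"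
      "irreducible_closedin (neg X) (neg X closure_of {x})"
      using xy(1) bi by (simp_all add: irreducible_closedin_closure_of_singleton)
    fix U V assume UV: "openin (pos X) U \<and> openin (neg X) V"
    then have "pos X closure_of {x} \<inter> U \<noteq> {} \<longleftrightarrow> x \<in> U" "neg X closure_of {x} \<inter> V \<noteq> {} \<longleftrightarrow> x \<in> V"
      using closure_of_singleton_Int by metis+
    with xy(1) show "U \<inter> V = {} \<Longrightarrow> pos X closure_of {x} \<inter> U = {} \<or> neg X closure_of {x} \<inter> V = {}"
      "U \<union> V = points X \<Longrightarrow> pos X closure_of {x} \<inter> U \<noteq> {} \<or> neg X closure_of {x} \<inter> V \<noteq> {}"
      by blast+
  qed
  ultimately show ?thesis
    using xy by blast
qed

text \<open>Existence in d-sobriety makes prime ideals converge and gives compactness; uniqueness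
  gives \<open>T\<^sub>0\<close>.\<close>

lemma d_boolean_patch:
  assumes X: "d_spectral X"
  shows "d_boolean (patch X)"
  unfolding d_boolean_def
proof (intro conjI)
  have bi: "bitop_space X"
    using X by (simp add: d_spectral_def)
  note sub = patch_subbase[of X]
  have neg: "V \<subseteq> points X" if "V \<in> compact_opens (neg X)" for V
    using compact_opens_subset[OF that] bi by (simp add: bitop_space_def)
  show "bitop_space (patch X)" "zero_dimensional (patch X)"
    unfolding patch_def using bitop_space_bool_bitop zero_dimensional_bool_bitop sub by blast+
  show "compact_space (join_topology (patch X))"
    unfolding patch_def
  proof (rule compact_space_join_bool_bitop[OF sub])
    fix N assume N: "prime_ideal_on (points X) N"
    obtain x where x: "x \<in> points X" "\<And>U. U \<in> compact_opens (pos X) \<Longrightarrow> x \<in> U \<longleftrightarrow> U \<notin> N"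
      "\<And>U. U \<in> compact_opens (neg X) \<Longrightarrow> x \<in> U \<longleftrightarrow> U \<notin> N"
      using prime_ideal_point[OF X N] by blast
    have "x \<in> points X - V \<longleftrightarrow> points X - V \<notin> N" if "V \<in> compact_opens (neg X)" for V
      using x(1) x(3)[OF that] prime_ideal_on_compl[OF N neg[OF that]] by blast
    with x show "\<exists>x\<in>points X. \<forall>U\<in>compact_opens (pos X) \<union> (-) (points X) ` compact_opens (neg X).
        x \<in> U \<longleftrightarrow> U \<notin> N"
      by (intro bexI[of _ x]) auto
  qed
  show "t0_space (join_topology (patch X))"
    unfolding patch_def
  proof (rule t0_space_bool_bitop[OF sub], rule ccontr)
    let ?\<P> = "compact_opens (pos X) \<union> (-) (points X) ` compact_opens (neg X)"
    fix x y assume xy: "x \<in> points X" "y \<in> points X" "x \<noteq> y"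
      and no_sep: "\<not> (\<exists>U\<in>?\<P>. x \<in> U \<longleftrightarrow> y \<notin> U)"
    have same: "x \<in> U \<longleftrightarrow> y \<in> U" if "U \<in> ?\<P>" for U
    proof (rule ccontr)
      assume "\<not> (x \<in> U \<longleftrightarrow> y \<in> U)"
      then have "x \<in> U \<longleftrightarrow> y \<notin> U"
        by simp
      with no_sep that show False
        by (elim notE) (rule bexI)
    qed
    have "x = y"
    proof (rule d_spectral_point_eqI[OF X xy(1,2)])
      show "x \<in> U \<longleftrightarrow> y \<in> U" if "U \<in> compact_opens (pos X)" for U
        using that same[of U] by simp
      show "x \<in> V \<longleftrightarrow> y \<in> V" if "V \<in> compact_opens (neg X)" for V
        using that same[of "points X - V"] xy(1,2) by simp
    qed
    with xy(3) show False ..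
  qed
qed

section \<open>Universal property of the patch\<close>

text \<open>The compact open sets of \<open>T\<close> form a base, so continuity follows from the
  condition on their preimages.\<close>

lemma spectral_map_iff:
  assumes T: "coherent_frame {U. openin T U}"
  shows "spectral_map S T f \<longleftrightarrow> f ` topspace S \<subseteq> topspace T \<and>
    (\<forall>U\<in>compact_opens T. {x \<in> topspace S. f x \<in> U} \<in> compact_opens S)"
proof
  show "spectral_map S T f \<Longrightarrow> f ` topspace S \<subseteq> topspace T \<and>
    (\<forall>U\<in>compact_opens T. {x \<in> topspace S. f x \<in> U} \<in> compact_opens S)"
    unfolding spectral_map_def compact_opens_def
    by (simp add: continuous_map_image_subset_topspace)
next
  assume f: "f ` topspace S \<subseteq> topspace T \<and>
    (\<forall>U\<in>compact_opens T. {x \<in> topspace S. f x \<in> U} \<in> compact_opens S)"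
  have "continuous_map S T f"
  proof (rule continuous_map_into_topology_base[where P = "\<lambda>U. U \<in> compact_opens T"])
    show "openin T = arbitrary union_of (\<lambda>U. U \<in> compact_opens T)"
      unfolding openin_topology_base_unique
      using coherent_base[OF T] by (metis (no_types, lifting) compact_opens_def mem_Collect_eq)
  qed (use f in \<open>auto simp: compact_opens_def\<close>)
  with f show "spectral_map S T f"
    by (simp add: spectral_map_def compact_opens_def)
qed

text \<open>Compact open sets of \<open>Y\<close> are biclopen or, for \<open>neg Y\<close>,
  complements of biclopen sets. After passing to complements both sides ask that the subbase of the
  patch pull back to biclopen sets of \<open>Y\<close>.\<close>

lemma d_spectral_map_iff_patch:
  assumes Y: "d_boolean Y" and X: "d_spectral X"
  shows "d_spectral_map Y X f \<longleftrightarrow> bicontinuous Y (patch X) f"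
proof -
  have bi: "bitop_space X" "bitop_space Y" and coh: "coherent_frame {U. openin (pos X) U}"
    "coherent_frame {U. openin (neg X) U}"
    using X Y by (auto simp: d_spectral_def d_boolean_def)
  have top: "topspace (neg X) = points X" "topspace (neg Y) = points Y"
    using bi by (auto simp: bitop_space_def)
  have neg: "compact_opens (neg Y) = biclopens (swap Y)"
    using compact_opens_d_boolean[of "swap Y"] Y by simp
  have "{y \<in> points Y. f y \<in> V} \<in> biclopens (swap Y) \<longleftrightarrow>
      {y \<in> points Y. f y \<in> points X - V} \<in> biclopens Y"
    if "f ` points Y \<subseteq> points X" for V
  proof -
    have "{y \<in> points Y. f y \<in> points X - V} = points Y - {y \<in> points Y. f y \<in> V}"
      using that by auto
    then show ?thesis
      using biclopens_swap[OF bi(2)] by simp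
  qed
  then show ?thesis
    unfolding d_spectral_map_def spectral_map_iff[OF coh(1)] spectral_map_iff[OF coh(2)]
      patch_def bicontinuous_bool_bitop[OF patch_subbase bi(2)]
      compact_opens_d_boolean[OF Y] neg top ball_Un ball_simps
    by blast
qed

section \<open>The reflection\<close>

definition representative :: "'a bitop \<Rightarrow> 'a \<Rightarrow> 'a" where
  "representative X x = (SOME y. y \<in> points X \<and> (\<forall>U\<in>biclopens X. y \<in> U \<longleftrightarrow> x \<in> U))"

text \<open>A biclopen set contains a point iff it contains its representative, so its trace on the
  representatives is its image in the quotient.\<close>

definition reflection :: "'a bitop \<Rightarrow> 'a bitop" where
  "reflection X = bool_bitop (representative X ` points X)
     ((\<lambda>U. U \<inter> representative X ` points X) ` biclopens X)"

lemma representative: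
  assumes "x \<in> points X"
  shows "representative X x \<in> points X"
    "U \<in> biclopens X \<Longrightarrow> representative X x \<in> U \<longleftrightarrow> x \<in> U"
proof -
  have "\<exists>y. y \<in> points X \<and> (\<forall>U\<in>biclopens X. y \<in> U \<longleftrightarrow> x \<in> U)"
    using assms by auto
  then have *: "representative X x \<in> points X \<and> (\<forall>U\<in>biclopens X. representative X x \<in> U \<longleftrightarrow> x \<in> U)"
    unfolding representative_def by (rule someI_ex)
  show "representative X x \<in> points X"
    using * by (rule conjunct1)
  show "U \<in> biclopens X \<Longrightarrow> representative X x \<in> U \<longleftrightarrow> x \<in> U"
    using * by (elim conjE) (rule bspec)
qed

text \<open>The predicate under \<open>SOME\<close> depends on \<open>x\<close> only through the
  biclopen sets containing it. So each inseparability class has a single representative.\<close>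

lemma representative_cong:
  assumes "\<And>U. U \<in> biclopens X \<Longrightarrow> x \<in> U \<longleftrightarrow> x' \<in> U"
  shows "representative X x = representative X x'"
proof -
  have "(y \<in> points X \<and> (\<forall>U\<in>biclopens X. y \<in> U \<longleftrightarrow> x \<in> U)) \<longleftrightarrow>
      (y \<in> points X \<and> (\<forall>U\<in>biclopens X. y \<in> U \<longleftrightarrow> x' \<in> U))" for y
    by (intro conj_cong refl ball_cong) (simp add: assms)
  then show ?thesis
    unfolding representative_def by (simp only:)
qed

lemma reflection_subbase:
  "(\<lambda>U. U \<inter> representative X ` points X) ` biclopens X \<subseteq> Pow (representative X ` points X)"
  by auto

lemma points_reflection: "points (reflection X) = representative X ` points X"
  unfolding reflection_def by (rule points_bool_bitop(1)[OF reflection_subbase])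

lemma points_reflection_subset: "points (reflection X) \<subseteq> points X"
  using representative(1) by (auto simp: points_reflection)

lemma bitop_space_reflection: "bitop_space (reflection X)"
  unfolding reflection_def by (rule bitop_space_bool_bitop[OF reflection_subbase])

lemma bicontinuous_representative:
  assumes "bitop_space X"
  shows "bicontinuous X (reflection X) (representative X)"
  unfolding reflection_def bicontinuous_bool_bitop[OF reflection_subbase assms]
proof (intro conjI ballI subset_refl)
  fix W assume "W \<in> (\<lambda>U. U \<inter> representative X ` points X) ` biclopens X"
  then obtain U where U: "U \<in> biclopens X" "W = U \<inter> representative X ` points X"
    by blast
  have "U \<subseteq> points X"
    using U(1) by (simp add: biclopens_def openin_subset)
  \<comment> \<open>A biclopen set is a union of inseparability classes, so its trace pulls back to
    the set itself.\<close>
  then have "{x \<in> points X. representative X x \<in> W} = U"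
    using representative(2)[OF _ U(1)] unfolding U(2) by auto
  then show "{x \<in> points X. representative X x \<in> W} \<in> biclopens X"
    using U(1) by simp
qed

lemma bicontinuous_join:
  assumes f: "bicontinuous X Y f" and bi: "bitop_space X" "bitop_space Y"
  shows "continuous_map (join_topology X) (join_topology Y) f"
  unfolding join_topology_def[of Y]
proof (rule continuous_on_generated_topo)
  have top: "topspace (neg X) = points X"
    using bi(1) by (simp add: bitop_space_def)
  show "f ` topspace (join_topology X) \<subseteq> \<Union> ({U. openin (pos Y) U} \<union> {V. openin (neg Y) V})"
    using f bi topspace_join[OF bi(1)] openin_topspace[of "pos Y"]
    unfolding bicontinuous_def by (metis (mono_tags, lifting) Sup_upper UnI1
        continuous_map_image_subset_topspace mem_Collect_eq subset_trans)
  fix U assume "U \<in> {U. openin (pos Y) U} \<union> {V. openin (neg Y) V}"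
  then show "openin (join_topology X) (f -` U \<inter> topspace (join_topology X))"
    using f top openin_join_pos[of X "f -` U \<inter> points X"] openin_join_neg[of X "f -` U \<inter> points X"]
    unfolding topspace_join[OF bi(1)] bicontinuous_def continuous_map_alt by auto
qed

text \<open>Compactness is inherited as a continuous image in the join topologies. Distinct
  representatives come from points that some biclopen set separates, which gives
  \<open>T\<^sub>0\<close>.\<close>

lemma d_boolean_reflection:
  assumes X: "bitop_space X" "compact_space (join_topology X)"
  shows "d_boolean (reflection X)"
  unfolding d_boolean_def
proof (intro conjI bitop_space_reflection)
  show "zero_dimensional (reflection X)"
    unfolding reflection_def by (rule zero_dimensional_bool_bitop[OF reflection_subbase])
  have "compactin (join_topology (reflection X)) (representative X ` points X)"
    using X(2) topspace_join[OF X(1)]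
    by (intro image_compactin[OF _ bicontinuous_join[OF bicontinuous_representative[OF X(1)] X(1)
            bitop_space_reflection]]) (simp add: compact_space_def)
  then show "compact_space (join_topology (reflection X))"
    by (simp add: compact_space_def topspace_join[OF bitop_space_reflection] points_reflection)
  show "t0_space (join_topology (reflection X))"
    unfolding reflection_def
  proof (rule t0_space_bool_bitop[OF reflection_subbase])
    fix a b assume "a \<in> representative X ` points X" "b \<in> representative X ` points X" "a \<noteq> b"
    then obtain x y where xy: "x \<in> points X" "a = representative X x"
        "y \<in> points X" "b = representative X y" and ne: "representative X x \<noteq> representative X y"
      by blast
    obtain U where U: "U \<in> biclopens X" "x \<in> U \<longleftrightarrow> y \<notin> U"
      using representative_cong[of X x y] ne by blast
    then have "a \<in> U \<longleftrightarrow> b \<notin> U"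
      using representative(2) xy by metis
    with U(1) xy show "\<exists>U\<in>(\<lambda>U. U \<inter> representative X ` points X) ` biclopens X. a \<in> U \<longleftrightarrow> b \<notin> U"
      by (intro bexI[of _ "U \<inter> representative X ` points X"]) auto
  qed
qed

section \<open>Universal property of the reflection\<close>

text \<open>Biclopen sets and their complements are the compact open sets of the two topologies, and
  these separate points of a d-spectral space.\<close>

lemma d_boolean_eqI:
  assumes Y: "d_boolean Y" and xy: "x \<in> points Y" "y \<in> points Y"
    and same: "\<And>U. U \<in> biclopens Y \<Longrightarrow> x \<in> U \<longleftrightarrow> y \<in> U"
  shows "x = y"
proof -
  have bi: "bitop_space Y"
    using Y by (simp add: d_boolean_def)
  have compl: "x \<in> V \<longleftrightarrow> y \<in> V" if "V \<in> compact_opens (neg Y)" for V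
  proof -
    have "V \<in> biclopens (swap Y)"
      using that compact_opens_d_boolean[of "swap Y"] Y by simp
    then have "points Y - V \<in> biclopens Y"
      by (simp add: biclopens_swap[OF bi])
    with same xy show ?thesis
      by blast
  qed
  show ?thesis
    using same compl compact_opens_d_boolean[OF Y]
    by (intro d_spectral_point_eqI[OF d_boolean_d_spectral[OF Y] xy]) simp_all
qed

text \<open>Biclopen sets form a base of \<open>pos Y\<close> and their complements one of
  \<open>neg Y\<close>.\<close>

lemma bicontinuous_into_d_boolean:
  assumes Y: "d_boolean Y" and X: "bitop_space X"
  shows "bicontinuous X Y f \<longleftrightarrow>
    f ` points X \<subseteq> points Y \<and> (\<forall>U\<in>biclopens Y. {x \<in> points X. f x \<in> U} \<in> biclopens X)"
proof
  assume f: "bicontinuous X Y f"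
  then have "f ` points X \<subseteq> points Y"
    by (simp add: bicontinuous_def continuous_map_image_subset_topspace)
  with f X show "f ` points X \<subseteq> points Y \<and>
    (\<forall>U\<in>biclopens Y. {x \<in> points X. f x \<in> U} \<in> biclopens X)"
    by (simp add: bicontinuous_vimage_biclopens)
next
  assume f: "f ` points X \<subseteq> points Y \<and> (\<forall>U\<in>biclopens Y. {x \<in> points X. f x \<in> U} \<in> biclopens X)"
  have bi: "bitop_space Y" and top: "topspace (neg Y) = points Y" "topspace (neg X) = points X"
    and Y': "d_boolean (swap Y)"
    using Y X by (simp_all add: d_boolean_def bitop_space_def)
  have "continuous_map (pos X) (pos Y) f"
    by (rule continuous_map_into_topology_base[OF openin_d_boolean[OF Y]])
      (use f in \<open>auto simp: biclopens_def\<close>)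
  moreover have "continuous_map (neg X) (neg Y) f"
  proof (rule continuous_map_into_topology_base[OF openin_d_boolean[OF Y', simplified]])
    show "f x \<in> topspace (neg Y)" if "x \<in> topspace (neg X)" for x
      using f that top by auto
    fix V assume "V \<in> biclopens (swap Y)"
    then have "points Y - V \<in> biclopens Y"
      by (simp add: biclopens_swap[OF bi])
    with f have "{x \<in> points X. f x \<in> points Y - V} \<in> biclopens X"
      by (elim conjE) (rule bspec)
    moreover have "{x \<in> points X. f x \<in> points Y - V} = points X - {x \<in> points X. f x \<in> V}"
      using f by auto
    ultimately have "{x \<in> points X. f x \<in> V} \<in> biclopens (swap X)"
      by (simp add: biclopens_swap[OF X])
    then show "openin (neg X) {x \<in> topspace (neg X). f x \<in> V}"
      by (simp add: biclopens_def top)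
  qed
  ultimately show "bicontinuous X Y f"
    by (simp add: bicontinuous_def)
qed

text \<open>A biclopen set of \<open>Y\<close> separating the two values would pull back to one of
  \<open>X\<close> separating \<open>x\<close> from its representative.\<close>

lemma bicontinuous_apply_representative:
  assumes Y: "d_boolean Y" and X: "bitop_space X" and f: "bicontinuous X Y f" and x: "x \<in> points X"
  shows "f (representative X x) = f x"
proof (rule d_boolean_eqI[OF Y])
  have maps: "f ` points X \<subseteq> points Y"
    using f bicontinuous_into_d_boolean[OF Y X] by simp
  then show "f (representative X x) \<in> points Y" "f x \<in> points Y"
    using representative(1)[OF x] x by auto
  show "f (representative X x) \<in> U \<longleftrightarrow> f x \<in> U" if "U \<in> biclopens Y" for U
    using representative(2)[OF x, of "{x \<in> points X. f x \<in> U}"] representative(1)[OF x] x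
      bicontinuous_vimage_biclopens[OF f X that] by simp
qed

text \<open>The factorisation of \<open>f\<close> through the quotient is \<open>f\<close> itself,
  evaluated on representatives.\<close>

lemma bicontinuous_on_reflection:
  assumes Y: "d_boolean Y" and X: "bitop_space X" and f: "bicontinuous X Y f"
  shows "bicontinuous (reflection X) Y f"
  unfolding bicontinuous_into_d_boolean[OF Y bitop_space_reflection]
proof (intro conjI ballI)
  show "f ` points (reflection X) \<subseteq> points Y"
    using f bicontinuous_into_d_boolean[OF Y X] image_mono[OF points_reflection_subset, of f X]
    by (simp add: subset_trans)
  fix U assume "U \<in> biclopens Y"
  then have "{x \<in> points X. f x \<in> U} \<in> biclopens X"
    using bicontinuous_vimage_biclopens[OF f X] by simp
  then have "{x \<in> points X. f x \<in> U} \<inter> representative X ` points X \<in> biclopens (reflection X)"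
    unfolding reflection_def by (intro subbase_biclopens[OF reflection_subbase]) simp
  moreover have "{x \<in> points X. f x \<in> U} \<inter> representative X ` points X =
      {x \<in> points (reflection X). f x \<in> U}"
    using points_reflection_subset[of X] unfolding points_reflection by auto
  ultimately show "{x \<in> points (reflection X). f x \<in> U} \<in> biclopens (reflection X)"
    by simp
qed

section \<open>Categories of bitopological spaces\<close>

lemma categoryD:
  assumes "category C"
  shows "X \<in> obj C \<Longrightarrow> ident C X \<in> hom C X X"
    "X \<in> obj C \<Longrightarrow> Y \<in> obj C \<Longrightarrow> Z \<in> obj C \<Longrightarrow> f \<in> hom C X Y \<Longrightarrow> g \<in> hom C Y Z \<Longrightarrow>
      comp C X Y Z g f \<in> hom C X Z"
    "X \<in> obj C \<Longrightarrow> Y \<in> obj C \<Longrightarrow> f \<in> hom C X Y \<Longrightarrow> comp C X X Y f (ident C X) = f"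
    "X \<in> obj C \<Longrightarrow> Y \<in> obj C \<Longrightarrow> f \<in> hom C X Y \<Longrightarrow> comp C X Y Y (ident C Y) f = f"
    "W \<in> obj C \<Longrightarrow> X \<in> obj C \<Longrightarrow> Y \<in> obj C \<Longrightarrow> Z \<in> obj C \<Longrightarrow>
      f \<in> hom C W X \<Longrightarrow> g \<in> hom C X Y \<Longrightarrow> h \<in> hom C Y Z \<Longrightarrow>
      comp C W X Z (comp C X Y Z h g) f = comp C W Y Z h (comp C W X Y g f)"
  using assms by (simp_all add: category_def)

lemma full_subcategoryD:
  assumes "full_subcategory B C"
  shows "category B" "category C" "X \<in> obj B \<Longrightarrow> X \<in> obj C"
    "X \<in> obj B \<Longrightarrow> Y \<in> obj B \<Longrightarrow> hom B X Y = hom C X Y"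
    "X \<in> obj B \<Longrightarrow> ident B X = ident C X"
    "X \<in> obj B \<Longrightarrow> Y \<in> obj B \<Longrightarrow> Z \<in> obj B \<Longrightarrow> f \<in> hom C X Y \<Longrightarrow> g \<in> hom C Y Z \<Longrightarrow>
      comp B X Y Z g f = comp C X Y Z g f"
  using assms by (auto simp: full_subcategory_def)

lemma is_functor_inclusion:
  assumes "full_subcategory B C"
  shows "is_functor B C inclusion"
  using assms by (auto simp: is_functor_def inclusion_def full_subcategory_def)

text \<open>The arrows \<open>\<eta> X\<close> determine the left adjoint: a morphism
  \<open>h\<close> is sent to the unique extension of \<open>\<eta> Y\<close> after
  \<open>h\<close>, and functoriality follows from uniqueness. The hypotheses mention only homs of
  \<open>C\<close>; fullness transfers them to \<open>B\<close>.\<close>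

lemma reflective_subcategoryI:
  assumes BC: "full_subcategory B C"
    and R: "\<And>X. X \<in> obj C \<Longrightarrow> R X \<in> obj B"
    and \<eta>: "\<And>X. X \<in> obj C \<Longrightarrow> \<eta> X \<in> hom C X (R X)"
    and uni: "\<And>X Y f. X \<in> obj C \<Longrightarrow> Y \<in> obj B \<Longrightarrow> f \<in> hom C X Y \<Longrightarrow>
      \<exists>!g. g \<in> hom C (R X) Y \<and> comp C X (R X) Y g (\<eta> X) = f"
  shows "reflective_subcategory B C"
proof -
  note sub = full_subcategoryD[OF BC]
  note cat = categoryD[OF sub(2)]
  have RC: "R X \<in> obj C" if "X \<in> obj C" for X
    using R sub(3) that by blast
  define ext where "ext X Y f = (THE g. g \<in> hom C (R X) Y \<and> comp C X (R X) Y g (\<eta> X) = f)" for X Y f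
  have ext: "ext X Y f \<in> hom C (R X) Y" "comp C X (R X) Y (ext X Y f) (\<eta> X) = f"
    if "X \<in> obj C" "Y \<in> obj B" "f \<in> hom C X Y" for X Y f
    using theI'[OF uni[OF that]] by (simp_all add: ext_def)
  have ext_eqI: "g = ext X Y f"
    if "X \<in> obj C" "Y \<in> obj B" "g \<in> hom C (R X) Y" "comp C X (R X) Y g (\<eta> X) = f" for X Y f g
  proof -
    have "f \<in> hom C X Y"
      using cat(2)[OF that(1) RC[OF that(1)] sub(3)[OF that(2)] \<eta>[OF that(1)] that(3)] that(4) by simp
    with that show ?thesis
      using uni[OF that(1,2)] ext[OF that(1,2)] by blast
  qed
  define F :: "('a, 'b, 'a, 'b) ftor" where
    "F = \<lparr>omap = R, amap = (\<lambda>X Y h. ext X (R Y) (comp C X Y (R Y) (\<eta> Y) h))\<rparr>"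
  have omap [simp]: "omap F = R"
    by (simp add: F_def)
  have amap: "amap F X Y h \<in> hom C (R X) (R Y)"
    "comp C X (R X) (R Y) (amap F X Y h) (\<eta> X) = comp C X Y (R Y) (\<eta> Y) h"
    if X: "X \<in> obj C" and Y: "Y \<in> obj C" and h: "h \<in> hom C X Y" for X Y h
    using ext[OF X R[OF Y] cat(2)[OF X Y RC[OF Y] h \<eta>[OF Y]]] by (simp_all add: F_def)
  have amap_eqI: "amap F X Y h = g"
    if "X \<in> obj C" "Y \<in> obj C" "g \<in> hom C (R X) (R Y)"
      "comp C X (R X) (R Y) g (\<eta> X) = comp C X Y (R Y) (\<eta> Y) h" for X Y h g
    using ext_eqI[OF that(1) R[OF that(2)] that(3,4)] by (simp add: F_def)
  have F: "is_functor C B F"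
    unfolding is_functor_def omap
  proof (intro conjI ballI)
    fix X assume X: "X \<in> obj C"
    show "R X \<in> obj B"
      by (rule R[OF X])
    show "amap F X X (ident C X) = ident B (R X)"
      unfolding sub(5)[OF R[OF X]] using X RC[OF X] \<eta>[OF X]
      by (intro amap_eqI) (simp_all add: cat)
    fix Y assume Y: "Y \<in> obj C"
    show "amap F X Y f \<in> hom B (R X) (R Y)" if "f \<in> hom C X Y" for f
      using amap(1)[OF X Y that] by (simp add: sub(4) R X Y)
    fix Z f g assume Z: "Z \<in> obj C" and f: "f \<in> hom C X Y" and g: "g \<in> hom C Y Z"
    note obs = X Y Z RC[OF X] RC[OF Y] RC[OF Z]
    \<comment> \<open>The composite of the two images satisfies the equation that characterises the
      image of the composite.\<close>
    have "amap F X Z (comp C X Y Z g f) = comp C (R X) (R Y) (R Z) (amap F Y Z g) (amap F X Y f)"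
    proof (rule amap_eqI[OF X Z])
      show "comp C (R X) (R Y) (R Z) (amap F Y Z g) (amap F X Y f) \<in> hom C (R X) (R Z)"
        using amap(1) obs f g by (simp add: cat(2))
      have "comp C X (R X) (R Z) (comp C (R X) (R Y) (R Z) (amap F Y Z g) (amap F X Y f)) (\<eta> X) =
          comp C X (R Y) (R Z) (amap F Y Z g) (comp C X (R X) (R Y) (amap F X Y f) (\<eta> X))"
        using amap(1) obs f g \<eta>[OF X] by (simp add: cat(5))
      also have "\<dots> = comp C X (R Y) (R Z) (amap F Y Z g) (comp C X Y (R Y) (\<eta> Y) f)"
        by (simp only: amap(2)[OF X Y f])
      also have "\<dots> = comp C X Y (R Z) (comp C Y (R Y) (R Z) (amap F Y Z g) (\<eta> Y)) f"
        by (rule cat(5)[symmetric]) (use obs f amap(1)[OF Y Z g] \<eta>[OF Y] in simp_all)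
      also have "\<dots> = comp C X Y (R Z) (comp C Y Z (R Z) (\<eta> Z) g) f"
        by (simp only: amap(2)[OF Y Z g])
      also have "\<dots> = comp C X Z (R Z) (\<eta> Z) (comp C X Y Z g f)"
        by (rule cat(5)) (use obs f g \<eta>[OF Z] in simp_all)
      finally show "comp C X (R X) (R Z)
          (comp C (R X) (R Y) (R Z) (amap F Y Z g) (amap F X Y f)) (\<eta> X) =
          comp C X Z (R Z) (\<eta> Z) (comp C X Y Z g f)" .
    qed
    then show "amap F X Z (comp C X Y Z g f) =
        comp B (R X) (R Y) (R Z) (amap F Y Z g) (amap F X Y f)"
      using amap(1) f g X Y Z R by (simp add: sub(6))
  qed
  \<comment> \<open>Precomposition with the unit; its inverse is \<open>ext\<close>.\<close>
  define \<phi> where "\<phi> X Y g = comp C X (R X) Y g (\<eta> X)" for X Y g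
  have "bij_betw (\<phi> X Y) (hom C (R X) Y) (hom C X Y)" if X: "X \<in> obj C" and Y: "Y \<in> obj B" for X Y
  proof (rule bij_betw_byWitness[where f' = "ext X Y"])
    show "\<forall>g\<in>hom C (R X) Y. ext X Y (\<phi> X Y g) = g"
      using ext_eqI[OF X Y] by (simp add: \<phi>_def)
    show "\<forall>f\<in>hom C X Y. \<phi> X Y (ext X Y f) = f"
      using ext(2)[OF X Y] by (simp add: \<phi>_def)
    show "\<phi> X Y ` hom C (R X) Y \<subseteq> hom C X Y"
      using cat(2)[OF X RC[OF X] sub(3)[OF Y] \<eta>[OF X]] by (auto simp: \<phi>_def)
    show "ext X Y ` hom C X Y \<subseteq> hom C (R X) Y"
      using ext(1)[OF X Y] by auto
  qed
  then have bij: "bij_betw (\<phi> X Y) (hom B (R X) Y) (hom C X Y)" if "X \<in> obj C" "Y \<in> obj B" for X Y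
    using that by (simp add: sub(4) R)
  have nat: "\<phi> X' Y' (comp B (R X') Y Y' k (comp B (R X') (R X) Y f (amap F X' X h))) =
      comp C X' Y Y' k (comp C X' X Y (\<phi> X Y f) h)"
    if X: "X \<in> obj C" and X': "X' \<in> obj C" and Y: "Y \<in> obj B" and Y': "Y' \<in> obj B"
      and h: "h \<in> hom C X' X" and f: "f \<in> hom B (R X) Y" and k: "k \<in> hom B Y Y'" for X X' Y Y' h f k
  proof -
    note obs = X X' RC[OF X] RC[OF X'] sub(3)[OF Y] sub(3)[OF Y']
    have f: "f \<in> hom C (R X) Y" and k: "k \<in> hom C Y Y'"
      using f k by (simp_all add: sub(4) R X Y Y')
    note homs = f k h amap[OF X' X h] \<eta>[OF X] \<eta>[OF X']
    have fh: "comp C (R X') (R X) Y f (amap F X' X h) \<in> hom C (R X') Y"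
      using obs homs by (simp add: cat(2))
    have "comp B (R X') Y Y' k (comp B (R X') (R X) Y f (amap F X' X h)) =
        comp C (R X') Y Y' k (comp C (R X') (R X) Y f (amap F X' X h))"
      using homs fh by (simp add: sub(6) R X X' Y Y')
    then have "\<phi> X' Y' (comp B (R X') Y Y' k (comp B (R X') (R X) Y f (amap F X' X h))) =
        comp C X' (R X') Y' (comp C (R X') Y Y' k (comp C (R X') (R X) Y f (amap F X' X h))) (\<eta> X')"
      by (simp only: \<phi>_def)
    also have "\<dots> = comp C X' Y Y' k (comp C X' (R X') Y
        (comp C (R X') (R X) Y f (amap F X' X h)) (\<eta> X'))"
      by (rule cat(5)) (use obs homs fh in simp_all)
    also have "\<dots> = comp C X' Y Y' k (comp C X' (R X) Y f
        (comp C X' (R X') (R X) (amap F X' X h) (\<eta> X')))"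
      using cat(5)[of X' "R X'" "R X" Y "\<eta> X'" "amap F X' X h" f] obs homs by (simp only:)
    also have "\<dots> = comp C X' Y Y' k (comp C X' (R X) Y f (comp C X' X (R X) (\<eta> X) h))"
      by (simp only: amap(2)[OF X' X h])
    also have "\<dots> = comp C X' Y Y' k (comp C X' X Y (\<phi> X Y f) h)"
      using cat(5)[of X' X "R X" Y h "\<eta> X" f] obs homs by (simp only: \<phi>_def)
    finally show ?thesis .
  qed
  have "left_adjoint C B F inclusion"
    unfolding left_adjoint_def
    using F is_functor_inclusion[OF BC] bij nat
    by (intro conjI exI[of _ \<phi>]) (simp_all add: inclusion_def)
  then show ?thesis
    using BC by (auto simp: reflective_subcategory_def)
qed

section \<open>The categories of spaces\<close>

lemma bitop_cat_sel [simp]: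
  "obj (bitop_cat Ob M) = Ob"
  "hom (bitop_cat Ob M) X Y = {f \<in> extensional (points X). M X Y f}"
  "ident (bitop_cat Ob M) X = restrict (\<lambda>x. x) (points X)"
  "comp (bitop_cat Ob M) X Y Z g f = compose (points X) g f"
  by (simp_all add: bitop_cat_def)

text \<open>Identities and composites are stored as extensional functions, which agree with
  \<open>\<lambda>x. x\<close> and \<open>g \<circ> f\<close> only on the points of the domain;
  \<open>cong\<close> bridges the difference.\<close>

lemma category_bitop_cat:
  assumes maps: "\<And>X Y f. X \<in> Ob \<Longrightarrow> M X Y f \<Longrightarrow> f \<in> points X \<rightarrow> points Y"
    and id: "\<And>X. X \<in> Ob \<Longrightarrow> M X X (\<lambda>x. x)"
    and comp: "\<And>X Y Z f g. M X Y f \<Longrightarrow> M Y Z g \<Longrightarrow> M X Z (g \<circ> f)"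
    and cong: "\<And>X Y f g. X \<in> Ob \<Longrightarrow> M X Y f \<Longrightarrow> (\<And>x. x \<in> points X \<Longrightarrow> f x = g x) \<Longrightarrow> M X Y g"
  shows "category (bitop_cat Ob M)"
proof -
  let ?C = "bitop_cat Ob M"
  show ?thesis
    unfolding category_def
  proof (intro conjI ballI)
    fix X assume "X \<in> obj ?C"
    then have X: "X \<in> Ob"
      by simp
    have "M X X (restrict (\<lambda>x. x) (points X))"
      by (rule cong[OF X id[OF X]]) simp
    then show "ident ?C X \<in> hom ?C X X"
      by simp
    fix Y f assume "Y \<in> obj ?C" and "f \<in> hom ?C X Y"
    then have Y: "Y \<in> Ob" and f: "f \<in> extensional (points X)" "M X Y f"
      by simp_all
    show "comp ?C X X Y f (ident ?C X) = f" "comp ?C X Y Y (ident ?C Y) f = f"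
      using compose_Id[OF maps[OF X f(2)] f(1)] Id_compose[OF maps[OF X f(2)] f(1)] by simp_all
    fix Z g assume "g \<in> hom ?C Y Z"
    then have g: "M Y Z g"
      by simp
    have "M X Z (compose (points X) g f)"
      by (rule cong[OF X comp[OF f(2) g]]) (simp add: compose_eq)
    then show "comp ?C X Y Z g f \<in> hom ?C X Z"
      by simp
    show "comp ?C X Y W (comp ?C Y Z W h g) f = comp ?C X Z W h (comp ?C X Y Z g f)" for W h
      using compose_assoc[OF maps[OF X f(2)], of h g] by simp
  qed
qed

lemma bicontinuous_comp: "bicontinuous X Y f \<Longrightarrow> bicontinuous Y Z g \<Longrightarrow> bicontinuous X Z (g \<circ> f)"
  by (auto simp: bicontinuous_def intro: continuous_map_compose)

lemma spectral_map_id: "spectral_map S S (\<lambda>x. x)"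
proof -
  have "{x \<in> topspace S. x \<in> U} = U" if "openin S U" for U
    using openin_subset[OF that] by auto
  then show ?thesis
    by (simp add: spectral_map_def)
qed

lemma spectral_map_comp:
  assumes f: "spectral_map S T f" and g: "spectral_map T R g"
  shows "spectral_map S R (g \<circ> f)"
  unfolding spectral_map_def
proof (intro conjI allI impI)
  have maps: "f x \<in> topspace T" if "x \<in> topspace S" for x
    using f that by (auto simp: spectral_map_def continuous_map_def)
  show "continuous_map S R (g \<circ> f)"
    using f g by (auto simp: spectral_map_def intro: continuous_map_compose)
  fix U assume "openin R U \<and> compactin R U"
  then have "openin T {x \<in> topspace T. g x \<in> U}" "compactin T {x \<in> topspace T. g x \<in> U}"
    using g by (simp_all add: spectral_map_def)
  then have "openin S {x \<in> topspace S. f x \<in> {x \<in> topspace T. g x \<in> U}}"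
    "compactin S {x \<in> topspace S. f x \<in> {x \<in> topspace T. g x \<in> U}}"
    using f by (simp_all only: spectral_map_def simp_thms)
  moreover have "{x \<in> topspace S. f x \<in> {x \<in> topspace T. g x \<in> U}} =
      {x \<in> topspace S. (g \<circ> f) x \<in> U}"
    using maps by auto
  ultimately show "openin S {x \<in> topspace S. (g \<circ> f) x \<in> U}"
    "compactin S {x \<in> topspace S. (g \<circ> f) x \<in> U}"
    by simp_all
qed

lemma d_spectral_map_comp:
  "d_spectral_map X Y f \<Longrightarrow> d_spectral_map Y Z g \<Longrightarrow> d_spectral_map X Z (g \<circ> f)"
  by (auto simp: d_spectral_map_def intro: spectral_map_comp)

lemma bicontinuous_cong:
  assumes "bitop_space X" "bicontinuous X Y f" "\<And>x. x \<in> points X \<Longrightarrow> f x = g x"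
  shows "bicontinuous X Y g"
  using assms continuous_map_eq unfolding bicontinuous_def bitop_space_def by metis

lemma spectral_map_cong:
  assumes f: "spectral_map S T f" and eq: "\<And>x. x \<in> topspace S \<Longrightarrow> f x = g x"
  shows "spectral_map S T g"
proof -
  have "continuous_map S T g"
    using f eq continuous_map_eq unfolding spectral_map_def by metis
  moreover have "{x \<in> topspace S. g x \<in> U} = {x \<in> topspace S. f x \<in> U}" for U
    using eq by auto
  ultimately show ?thesis
    using f by (simp add: spectral_map_def)
qed

lemma d_spectral_map_cong:
  assumes "bitop_space X" "d_spectral_map X Y f" "\<And>x. x \<in> points X \<Longrightarrow> f x = g x"
  shows "d_spectral_map X Y g"
  using assms spectral_map_cong unfolding d_spectral_map_def bitop_space_def by metis

lemma category_dBool: "category (dBool \<U>)"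
  unfolding dBool_def
proof (rule category_bitop_cat)
  show "f \<in> points X \<rightarrow> points Y" if "bicontinuous X Y f" for X Y :: "'a bitop" and f
    using that by (auto simp: bicontinuous_def continuous_map_def)
  show "bicontinuous X X (\<lambda>x. x)" for X :: "'a bitop"
    by (simp add: bicontinuous_def)
  show "bicontinuous X Z (g \<circ> f)" if "bicontinuous X Y f" "bicontinuous Y Z g"
    for X Y Z :: "'a bitop" and f g
    using that by (rule bicontinuous_comp)
  show "bicontinuous X Y g" if "X \<in> {X. d_boolean X \<and> points X \<in> \<U>}" "bicontinuous X Y f"
    "\<And>x. x \<in> points X \<Longrightarrow> f x = g x" for X Y :: "'a bitop" and f g
    using that by (intro bicontinuous_cong[of X Y f g]) (auto simp: d_boolean_def)
qed

lemma category_dSpec: "category (dSpec \<U>)"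
  unfolding dSpec_def
proof (rule category_bitop_cat)
  show "f \<in> points X \<rightarrow> points Y" if "d_spectral_map X Y f" for X Y :: "'a bitop" and f
    using that by (auto simp: d_spectral_map_def spectral_map_def continuous_map_def)
  show "d_spectral_map X X (\<lambda>x. x)" for X :: "'a bitop"
    by (simp add: d_spectral_map_def spectral_map_id)
  show "d_spectral_map X Z (g \<circ> f)" if "d_spectral_map X Y f" "d_spectral_map Y Z g"
    for X Y Z :: "'a bitop" and f g
    using that by (rule d_spectral_map_comp)
  show "d_spectral_map X Y g" if "X \<in> {X. d_spectral X \<and> points X \<in> \<U>}" "d_spectral_map X Y f"
    "\<And>x. x \<in> points X \<Longrightarrow> f x = g x" for X Y :: "'a bitop" and f g
    using that by (intro d_spectral_map_cong[of X Y f g]) (auto simp: d_spectral_def)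
qed

section \<open>The two adjunctions\<close>

lemma d_spectral_map_from_d_spectral:
  "d_spectral X \<Longrightarrow> d_boolean Y \<Longrightarrow> d_spectral_map X Y f \<longleftrightarrow> bicontinuous X Y f"
  by (intro d_spectral_map_into_d_boolean) (simp_all add: d_spectral_def)

lemma full_subcategory_dBool_dSpec: "full_subcategory (dBool \<U>) (dSpec \<U>)"
  unfolding full_subcategory_def
proof (intro conjI category_dBool category_dSpec)
  show "obj (dBool \<U>) \<subseteq> obj (dSpec \<U>)"
    by (auto simp: dBool_def dSpec_def d_boolean_d_spectral)
  show "\<forall>X\<in>obj (dBool \<U>). \<forall>Y\<in>obj (dBool \<U>). hom (dBool \<U>) X Y = hom (dSpec \<U>) X Y"
    by (simp add: dBool_def dSpec_def d_boolean_d_spectral d_spectral_map_from_d_spectral)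
qed (simp_all add: dBool_def dSpec_def)

lemma reflective_dBool_dSpec:
  fixes \<U> :: "'a set set"
  assumes \<U>: "\<And>A B. A \<in> \<U> \<Longrightarrow> B \<subseteq> A \<Longrightarrow> B \<in> \<U>"
  shows "reflective_subcategory (dBool \<U>) (dSpec \<U>)"
proof (rule reflective_subcategoryI[OF full_subcategory_dBool_dSpec,
      where R = reflection and \<eta> = "\<lambda>X. restrict (representative X) (points X)"])
  fix X assume "X \<in> obj (dSpec \<U>)"
  then have X: "d_spectral X" "bitop_space X" "points X \<in> \<U>"
    by (auto simp: dSpec_def d_spectral_def)
  have R: "d_boolean (reflection X)"
    using X(1) by (intro d_boolean_reflection) (simp_all add: d_spectral_def)
  then show "reflection X \<in> obj (dBool \<U>)"
    using \<U>[OF X(3) points_reflection_subset] by (simp add: dBool_def)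
  have "bicontinuous X (reflection X) (restrict (representative X) (points X))"
    by (rule bicontinuous_cong[OF X(2) bicontinuous_representative[OF X(2)]]) simp
  then show "restrict (representative X) (points X) \<in> hom (dSpec \<U>) X (reflection X)"
    by (simp add: dSpec_def d_spectral_map_from_d_spectral[OF X(1) R])
  fix Y f assume "Y \<in> obj (dBool \<U>)" and "f \<in> hom (dSpec \<U>) X Y"
  then have Y: "d_boolean Y" and f: "f \<in> extensional (points X)" "bicontinuous X Y f"
    using d_spectral_map_from_d_spectral[OF X(1)] by (auto simp: dBool_def dSpec_def)
  have hom: "hom (dSpec \<U>) (reflection X) Y =
      {g \<in> extensional (points (reflection X)). bicontinuous (reflection X) Y g}"
    by (simp add: dSpec_def d_spectral_map_from_d_spectral[OF d_boolean_d_spectral[OF R] Y])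
  have eta: "comp (dSpec \<U>) X (reflection X) Y g (restrict (representative X) (points X)) = f \<longleftrightarrow>
      (\<forall>x\<in>points X. g (representative X x) = f x)" for g
    using f(1) by (auto simp: dSpec_def compose_def fun_eq_iff extensional_def)
  \<comment> \<open>Representatives are points of \<open>X\<close>, where \<open>f\<close> is
    already defined; restricting only makes the function extensional on the smaller domain.\<close>
  let ?g = "restrict f (points (reflection X))"
  show "\<exists>!g. g \<in> hom (dSpec \<U>) (reflection X) Y \<and>
      comp (dSpec \<U>) X (reflection X) Y g (restrict (representative X) (points X)) = f"
    unfolding hom eta
  proof (rule ex1I[of _ ?g])
    have "bicontinuous (reflection X) Y ?g"
      by (rule bicontinuous_cong[OF bitop_space_reflection bicontinuous_on_reflection[OF Y X(2) f(2)]])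
        simp
    moreover have "?g (representative X x) = f x" if "x \<in> points X" for x
      using that bicontinuous_apply_representative[OF Y X(2) f(2) that] by (simp add: points_reflection)
    ultimately show "?g \<in> {g \<in> extensional (points (reflection X)). bicontinuous (reflection X) Y g} \<and>
        (\<forall>x\<in>points X. ?g (representative X x) = f x)"
      by simp
    fix g assume g: "g \<in> {g \<in> extensional (points (reflection X)). bicontinuous (reflection X) Y g} \<and>
        (\<forall>x\<in>points X. g (representative X x) = f x)"
    \<comment> \<open>Every point of the reflection is a representative, so the factorisation
      condition forces the value of \<open>g\<close> there.\<close>
    show "g = ?g"
    proof (rule extensionalityI[of _ "points (reflection X)"])
      fix z assume z: "z \<in> points (reflection X)"
      then obtain x where "x \<in> points X" "z = representative X x"
        by (auto simp: points_reflection)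
      with g z show "g z = ?g z"
        using bicontinuous_apply_representative[OF Y X(2) f(2), of x] by simp
    qed (use g in simp_all)
  qed
qed

text \<open>Morphisms from a d-Boolean \<open>Y\<close> to \<open>X\<close> and to
  \<open>patch X\<close> are the same functions, so \<open>G\<close> acts as the identity on
  morphisms and the adjunction bijection is the identity.\<close>

lemma coreflective_dBool_dSpec: "coreflective_subcategory (dBool \<U>) (dSpec \<U>)"
proof -
  define G :: "('a bitop, 'a \<Rightarrow> 'a, 'a bitop, 'a \<Rightarrow> 'a) ftor" where
    "G = \<lparr>omap = patch, amap = (\<lambda>X Y f. f)\<rparr>"
  have hom: "hom (dBool \<U>) Y (patch X) = hom (dSpec \<U>) Y X"
    if "Y \<in> obj (dBool \<U>)" "X \<in> obj (dSpec \<U>)" for X Y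
    using that d_spectral_map_iff_patch[of Y X] by (simp add: dBool_def dSpec_def)
  have obj: "patch X \<in> obj (dBool \<U>)" and points: "points (patch X) = points X"
    if "X \<in> obj (dSpec \<U>)" for X
    using that d_boolean_patch[of X] by (auto simp: dBool_def dSpec_def d_spectral_def)
  \<comment> \<open>The counit: the identity of \<open>patch X\<close>, read as a morphism into
    \<open>X\<close>.\<close>
  have id: "restrict (\<lambda>x. x) (points X) \<in> hom (dSpec \<U>) (patch X) X" if X: "X \<in> obj (dSpec \<U>)" for X
  proof -
    have "ident (dBool \<U>) (patch X) \<in> hom (dSpec \<U>) (patch X) X"
      using categoryD(1)[OF category_dBool obj[OF X]] by (simp only: hom[OF obj[OF X] X])
    then show ?thesis
      using points[OF X] by (simp add: dBool_def)
  qed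
  \<comment> \<open>Composing \<open>f\<close> with the counit of \<open>X\<close> gives a morphism
    from \<open>patch X\<close> to \<open>Y\<close> with the same underlying function; by
    \<open>hom\<close> it is a morphism into \<open>patch Y\<close>.\<close>
  have amap: "f \<in> hom (dBool \<U>) (patch X) (patch Y)"
    if X: "X \<in> obj (dSpec \<U>)" and Y: "Y \<in> obj (dSpec \<U>)" and f: "f \<in> hom (dSpec \<U>) X Y" for X Y f
  proof -
    have "patch X \<in> obj (dSpec \<U>)"
      using obj[OF X] full_subcategoryD(3)[OF full_subcategory_dBool_dSpec] by blast
    then have "comp (dSpec \<U>) (patch X) X Y f (restrict (\<lambda>x. x) (points X)) \<in> hom (dSpec \<U>) (patch X) Y"
      by (rule categoryD(2)[OF category_dSpec _ X Y id[OF X] f])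
    moreover have "comp (dSpec \<U>) (patch X) X Y f (restrict (\<lambda>x. x) (points X)) = f"
      using categoryD(3)[OF category_dSpec X Y f] points[OF X] by (simp add: dSpec_def)
    ultimately show ?thesis
      by (simp only: hom[OF obj[OF X] Y])
  qed
  have G: "is_functor (dSpec \<U>) (dBool \<U>) G"
    unfolding is_functor_def G_def ftor.simps
    using obj amap points by (auto simp: dSpec_def dBool_def)
  have "left_adjoint (dBool \<U>) (dSpec \<U>) inclusion G"
    unfolding left_adjoint_def
  proof (intro conjI G is_functor_inclusion[OF full_subcategory_dBool_dSpec]
      exI[of _ "\<lambda>X Y f. f"] ballI)
    fix Y X assume Y: "Y \<in> obj (dBool \<U>)" and X: "X \<in> obj (dSpec \<U>)"
    show "bij_betw (\<lambda>f. f) (hom (dSpec \<U>) (omap inclusion Y) X) (hom (dBool \<U>) Y (omap G X))"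
      using hom[OF Y X] by (simp add: inclusion_def G_def bij_betw_def)
  next
    fix Y Y' X X' h f k
    assume Y: "Y \<in> obj (dBool \<U>)" "Y' \<in> obj (dBool \<U>)" and X: "X \<in> obj (dSpec \<U>)" "X' \<in> obj (dSpec \<U>)"
      and h: "h \<in> hom (dBool \<U>) Y' Y" and f: "f \<in> hom (dSpec \<U>) (omap inclusion Y) X"
      and k: "k \<in> hom (dSpec \<U>) X X'"
    show "comp (dSpec \<U>) (omap inclusion Y') X X' k
        (comp (dSpec \<U>) (omap inclusion Y') (omap inclusion Y) X f (amap inclusion Y' Y h)) =
      comp (dBool \<U>) Y' (omap G X) (omap G X') (amap G X X' k)
        (comp (dBool \<U>) Y' Y (omap G X) f h)"
      by (simp add: inclusion_def G_def dSpec_def dBool_def)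
  qed
  then show ?thesis
    using full_subcategory_dBool_dSpec by (auto simp: coreflective_subcategory_def)
qed

text \<open>Closure of \<open>\<U>\<close> under subsets keeps the reflection inside the universe.
  It holds for \<open>UNIV\<close> and for the sets of cardinality below a bound.\<close>

theorem theorem6p5:
  fixes \<U> :: "'a set set"
  assumes "\<And>A B. A \<in> \<U> \<Longrightarrow> B \<subseteq> A \<Longrightarrow> B \<in> \<U>"
  shows "reflective_subcategory (dBool \<U>) (dSpec \<U>) \<and>
         coreflective_subcategory (dBool \<U>) (dSpec \<U>)"
  by (intro conjI reflective_dBool_dSpec coreflective_dBool_dSpec) (rule assms)

end
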